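(* Let $I=[a,b]$ and let $\mathcal{L}, \mathcal{M} \in \mathcal{P}(I)$ be homotopic with fixed endpoints, i.e., there is a family $\mathcal{H}_s$, $s\in[0,1]$, with $\mathcal{H}_0 = \mathcal{L}$, $\mathcal{H}_1 = \mathcal{M}$, such that $(t,s) \mapsto \mathcal{H}_s(t)$ is continuous from $[a,b]\times[0,1]$ into $\Lambda(n)\times\Lambda(n)$, and $\mathcal{H}_s(a) = \mathcal{L}(a) = \mathcal{M}(a)$ and $\mathcal{H}_s(b) = \mathcal{L}(b) = \mathcal{M}(b)$ for all $s\in[0,1]$. Then $$\operatorname{Mas}(\mathcal{L};[a,b]) = \operatorname{Mas}(\mathcal{M};[a,b]).$$
   Context: Let $J = \begin{pmatrix} 0 & -I_n \\ I_n & 0 \end{pmatrix}$. A Lagrangian subspace of $\mathbb{R}^{2n}$ is an $n$-dimensional linear subspace $\ell$ with $(Jx,y)_{\mathbb{R}^{2n}}=0$ for all $x,y\in\ell$. $\Lambda(n)$ is the set of all Lagrangian subspaces, with the metric $d(\ell_1,\ell_2)=\|\mathcal{P}_1-\mathcal{P}_2\|$, where $\mathcal{P}_i$ is the orthogonal projection onto $\ell_i$ and $\|\cdot\|$ is any matrix norm; $\Lambda(n)\times\Lambda(n)$ carries the metric $\rho((\ell_1,\ell_2),(m_1,m_2)) = (d(\ell_1,m_1)^2+d(\ell_2,m_2)^2)^{1/2}$. $\mathcal{P}(I)$ denotes the collection of all paths $\mathcal{L}(t)=(\ell_1(t),\ell_2(t))$, $t \in I$, with $\ell_1,\ell_2:I\to\Lambda(n)$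 continuous. A frame for a Lagrangian subspace $\ell$ is a real $2n\times n$ matrix $\binom{X}{Y}$ ($X,Y$ real $n\times n$) whose columns form a basis of $\ell$; then $X\pm iY$ are invertible. For $\mathcal{L}(t)=(\ell_1(t),\ell_2(t))$ with frames $\binom{X_j(t)}{Y_j(t)}$ of $\ell_j(t)$, $j = 1,2$, set $$\tilde W(t) = -(X_1(t)+iY_1(t))(X_1(t)-iY_1(t))^{-1}(X_2(t)-iY_2(t))(X_2(t)+iY_2(t))^{-1},$$ a unitary $n\times n$ complex matrix, independent of the choice of frames and continuous in $t$. Maslov index: choose a partition $a=t_0<t_1<\dots<t_N=b$ and numbers $\epsilon_j\in(0,\pi)$, $j = 1,\dots,N$, such that $e^{i(\pi\pm\epsilon_j)}\notin\sigma(\tilde W(t))$ for all $t\in[t_{j-1},t_j]$ (and such that for each $t \in [t_{j-1},t_j]$ only finitely many $\theta\in[0,\epsilon_j]$ satisfy $e^{i(\pi+\theta)}\in\sigma(\tilde W(t))$, which is automatic here). For $t\in[t_{j-1},t_j]$ set $$k(t,\epsilon_j)=\sum_{0\le\theta<\epsilon_j}\dim\ker\big(\tilde W(t)-e^{i(\pi+\theta)}I\big),$$ and define $$\operatorname{Mas}(\mathcal{L};I)=\sum_{j=1}^N\big(k(t_j,\epsilon_j)-k(t_{j-1},\epsilon_j)\big).$$ This is the spectral flow of $\tilde W$ through $-1$, counted positively in the counterclockwise direction; it does not depend on the choice of partition and of the $\epsilon_j$. *)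

theory Defs
  imports "HOL-Analysis.Analysis"
begin

text \<open>
  \<open>\<real>\<^sup>2\<^sup>n\<close> is \<open>real ^ ('n + 'n)\<close> with \<open>n = CARD('n)\<close>; the summands \<open>Inl\<close> and \<open>Inr\<close> index the upper and
  the lower block.
\<close>

definition J_mat :: "real ^ ('n + 'n) ^ ('n::finite + 'n)" where
  "J_mat = (\<chi> p q. case (p, q) of
       (Inl i, Inr j) \<Rightarrow> if i = j then -1 else 0
     | (Inr i, Inl j) \<Rightarrow> if i = j then 1 else 0
     | _ \<Rightarrow> 0)"

definition Lagrangian :: "(real ^ ('n::finite + 'n)) set \<Rightarrow> bool" where
  "Lagrangian l \<longleftrightarrow> subspace l \<and> dim l = CARD('n) \<and> (\<forall>x\<in>l. \<forall>y\<in>l. (J_mat *v x) \<bullet> y = 0)"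

definition Lagrangian_Grassmannian :: "(real ^ ('n::finite + 'n)) set set" where
  "Lagrangian_Grassmannian = {l. Lagrangian l}"

definition orth_proj :: "'a::euclidean_space set \<Rightarrow> 'a \<Rightarrow> 'a" where
  "orth_proj l x = (THE y. y \<in> l \<and> (\<forall>z\<in>l. orthogonal (x - y) z))"

lemma orth_proj_eqI:
  assumes "subspace l" "y \<in> l" "\<And>z. z \<in> l \<Longrightarrow> orthogonal (x - y) z"
  shows "orth_proj l x = y"
  unfolding orth_proj_def
proof (rule the_equality)
  show "y \<in> l \<and> (\<forall>z\<in>l. orthogonal (x - y) z)" using assms by blast
next
  fix y' assume y': "y' \<in> l \<and> (\<forall>z\<in>l. orthogonal (x - y') z)"
  then have d: "y' - y \<in> l" using assms subspace_diff by blast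
  then have "(x - y) \<bullet> (y' - y) = 0" "(x - y') \<bullet> (y' - y) = 0"
    using assms(3) y' by (auto simp: orthogonal_def)
  then have "(y' - y) \<bullet> (y' - y) = 0"
    by (simp add: inner_diff_left)
  then show "y' = y" by simp
qed

lemma orth_proj_props:
  assumes "subspace l"
  shows "orth_proj l x \<in> l" and "z \<in> l \<Longrightarrow> orthogonal (x - orth_proj l x) z"
proof -
  obtain y w where "y \<in> span l" and w: "\<And>z. z \<in> span l \<Longrightarrow> orthogonal w z" and x: "x = y + w"
    by (rule orthogonal_subspace_decomp_exists[where S = l and x = x]) (rule that)
  moreover have "span l = l" using assms by (simp add: span_eq_iff)
  ultimately have y: "y \<in> l" and w': "\<And>z. z \<in> l \<Longrightarrow> orthogonal (x - y) z" by auto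
  have "orth_proj l x = y" using orth_proj_eqI[OF assms y w'] .
  then show "orth_proj l x \<in> l" and "z \<in> l \<Longrightarrow> orthogonal (x - orth_proj l x) z"
    using y w' by auto
qed

lemma linear_orth_proj:
  assumes "subspace l"
  shows "linear (orth_proj l)"
proof (rule linearI)
  fix x y
  show "orth_proj l (x + y) = orth_proj l x + orth_proj l y"
  proof (rule orth_proj_eqI[OF assms])
    show "orth_proj l x + orth_proj l y \<in> l"
      by (intro subspace_add assms orth_proj_props(1))
    fix z assume "z \<in> l"
    then show "orthogonal (x + y - (orth_proj l x + orth_proj l y)) z"
      using orth_proj_props(2)[OF assms, of z x] orth_proj_props(2)[OF assms, of z y]
      by (simp add: orthogonal_def inner_diff_left inner_add_left)
  qed
next
  fix c x
  show "orth_proj l (c *\<^sub>R x) = c *\<^sub>R orth_proj l x"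
  proof (rule orth_proj_eqI[OF assms])
    show "c *\<^sub>R orth_proj l x \<in> l"
      by (intro subspace_scale assms orth_proj_props(1))
    fix z assume "z \<in> l"
    then show "orthogonal (c *\<^sub>R x - c *\<^sub>R orth_proj l x) z"
      using orth_proj_props(2)[OF assms, of z x]
      by (simp add: orthogonal_def inner_diff_left)
  qed
qed

lemma orth_proj_inj:
  fixes l m :: "'a::euclidean_space set"
  assumes "subspace l" "subspace m" "orth_proj l = orth_proj m"
  shows "l = m"
proof -
  have fixed: "orth_proj k x = x" if "subspace k" "x \<in> k" for k :: "'a set" and x
    using that by (intro orth_proj_eqI) (auto simp: orthogonal_def)
  have "x \<in> m" if "x \<in> l" for x
    using fixed[OF assms(1) that] orth_proj_props(1)[OF assms(2), of x] assms(3) by simp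
  moreover have "x \<in> l" if "x \<in> m" for x
    using fixed[OF assms(2) that] orth_proj_props(1)[OF assms(1), of x] assms(3) by simp
  ultimately show ?thesis by blast
qed

text \<open>Submultiplicativity is not required, so every customary notion of matrix norm is covered.\<close>

definition matrix_norm :: "(real ^ 'm ^ 'm \<Rightarrow> real) \<Rightarrow> bool" where
  "matrix_norm nrm \<longleftrightarrow>
     (\<forall>A. nrm A = 0 \<longleftrightarrow> A = 0) \<and>
     (\<forall>c A. nrm (c *\<^sub>R A) = \<bar>c\<bar> * nrm A) \<and>
     (\<forall>A B. nrm (A + B) \<le> nrm A + nrm B)"

definition Lagr_dist ::
  "(real ^ ('n + 'n) ^ ('n + 'n) \<Rightarrow> real) \<Rightarrow>
   (real ^ ('n::finite + 'n)) set \<Rightarrow> (real ^ ('n + 'n)) set \<Rightarrow> real" where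
  "Lagr_dist nrm l1 l2 = nrm (matrix (orth_proj l1) - matrix (orth_proj l2))"

lemma Metric_space_Lagr_dist:
  fixes nrm :: "real ^ ('n + 'n) ^ ('n::finite + 'n) \<Rightarrow> real"
  assumes "matrix_norm nrm"
  shows "Metric_space Lagrangian_Grassmannian (Lagr_dist nrm)"
proof
  have z: "nrm A = 0 \<longleftrightarrow> A = 0" and s: "nrm (c *\<^sub>R A) = \<bar>c\<bar> * nrm A"
    and tri: "nrm (A + B) \<le> nrm A + nrm B" for A B c
    using assms unfolding matrix_norm_def by blast+
  have m: "nrm (- A) = nrm A" for A
    using s[of "-1" A] by simp
  have nn: "0 \<le> nrm A" for A
    using tri[of A "- A"] m[of A] z[of 0] by simp
  fix x y w :: "(real ^ ('n + 'n)) set"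
  show "0 \<le> Lagr_dist nrm x y" by (simp add: Lagr_dist_def nn)
  show "Lagr_dist nrm x y = Lagr_dist nrm y x"
    using m[of "matrix (orth_proj x) - matrix (orth_proj y)"] by (simp add: Lagr_dist_def)
  show "Lagr_dist nrm x w \<le> Lagr_dist nrm x y + Lagr_dist nrm y w"
    using tri[of "matrix (orth_proj x) - matrix (orth_proj y)" "matrix (orth_proj y) - matrix (orth_proj w)"]
    by (simp add: Lagr_dist_def)
  assume "x \<in> Lagrangian_Grassmannian" "y \<in> Lagrangian_Grassmannian"
  then have sub: "subspace x" "subspace y"
    by (auto simp: Lagrangian_Grassmannian_def Lagrangian_def)
  show "Lagr_dist nrm x y = 0 \<longleftrightarrow> x = y"
  proof
    assume "Lagr_dist nrm x y = 0"
    then have eq: "matrix (orth_proj x) = matrix (orth_proj y)"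
      unfolding Lagr_dist_def z by (rule eq_iff_diff_eq_0[THEN iffD2])
    show "x = y"
    proof (rule orth_proj_inj[OF sub], rule ext)
      fix v
      show "orth_proj x v = orth_proj y v"
        using matrix_works[OF iffD2[OF linear_matrix_vector_mul_eq linear_orth_proj[OF sub(1)]], of v]
          matrix_works[OF iffD2[OF linear_matrix_vector_mul_eq linear_orth_proj[OF sub(2)]], of v]
        unfolding eq by simp
    qed
  next
    assume "x = y"
    then show "Lagr_dist nrm x y = 0"
      unfolding Lagr_dist_def z by simp
  qed
qed

definition Lagr_top ::
  "(real ^ ('n + 'n) ^ ('n + 'n) \<Rightarrow> real) \<Rightarrow> (real ^ ('n::finite + 'n)) set topology" where
  "Lagr_top nrm = Metric_space.mtopology Lagrangian_Grassmannian (Lagr_dist nrm)"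

text \<open>\<^const>\<open>prod_dist\<close> is the Euclidean combination \<open>\<rho>\<close> of the two distances.\<close>

definition Lagr_pair_top ::
  "(real ^ ('n + 'n) ^ ('n + 'n) \<Rightarrow> real) \<Rightarrow>
   ((real ^ ('n::finite + 'n)) set \<times> (real ^ ('n + 'n)) set) topology" where
  "Lagr_pair_top nrm =
     Metric_space.mtopology (Lagrangian_Grassmannian \<times> Lagrangian_Grassmannian)
       (prod_dist (Lagr_dist nrm) (Lagr_dist nrm))"

definition Lagr_paths ::
  "(real ^ ('n + 'n) ^ ('n + 'n) \<Rightarrow> real) \<Rightarrow> real set \<Rightarrow>
   (real \<Rightarrow> (real ^ ('n::finite + 'n)) set \<times> (real ^ ('n + 'n)) set) set" where
  "Lagr_paths nrm I =
     {L. continuous_map (top_of_set I) (Lagr_top nrm) (\<lambda>t. fst (L t)) \<and>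
         continuous_map (top_of_set I) (Lagr_top nrm) (\<lambda>t. snd (L t))}"

definition is_frame :: "real ^ 'n ^ ('n::finite + 'n) \<Rightarrow> (real ^ ('n + 'n)) set \<Rightarrow> bool" where
  "is_frame F l \<longleftrightarrow>
     inj (\<lambda>j. column j F) \<and> independent (columns F) \<and> span (columns F) = l"

definition frame_plus :: "real ^ 'n ^ ('n::finite + 'n) \<Rightarrow> complex ^ 'n ^ 'n" where
  "frame_plus F = (\<chi> i j. of_real (F $ Inl i $ j) + \<i> * of_real (F $ Inr i $ j))"

definition frame_minus :: "real ^ 'n ^ ('n::finite + 'n) \<Rightarrow> complex ^ 'n ^ 'n" where
  "frame_minus F = (\<chi> i j. of_real (F $ Inl i $ j) - \<i> * of_real (F $ Inr i $ j))"

definition W_frames :: "real ^ 'n ^ ('n + 'n) \<Rightarrow> real ^ 'n ^ ('n::finite + 'n) \<Rightarrow> complex ^ 'n ^ 'n" where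
  "W_frames F1 F2 =
     - (frame_plus F1 ** matrix_inv (frame_minus F1) ** frame_minus F2 ** matrix_inv (frame_plus F2))"

text \<open>\<^const>\<open>W_frames\<close> depends only on the subspaces spanned by the frames, so any choice of frames will do.\<close>

definition W_tilde ::
  "(real ^ ('n::finite + 'n)) set \<times> (real ^ ('n + 'n)) set \<Rightarrow> complex ^ 'n ^ 'n" where
  "W_tilde l = W_frames (SOME F. is_frame F (fst l)) (SOME F. is_frame F (snd l))"

definition mat_spectrum :: "complex ^ 'n ^ 'n \<Rightarrow> complex set" where
  "mat_spectrum A = {z. \<not> invertible (A - mat z)}"

text \<open>
  \<^term>\<open>vec.dim\<close> is the dimension over the complex numbers. The sum ranges over those \<open>\<theta>\<close> whose
  kernel is nonzero, since \<^const>\<open>sum\<close> over an infinite set is \<open>0\<close> by convention.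
\<close>

definition crossing_count :: "complex ^ 'n ^ 'n \<Rightarrow> real \<Rightarrow> nat" where
  "crossing_count A \<epsilon> =
     (\<Sum>\<theta> | 0 \<le> \<theta> \<and> \<theta> < \<epsilon> \<and> cis (pi + \<theta>) \<in> mat_spectrum A.
        vec.dim {v. (A - mat (cis (pi + \<theta>))) *v v = 0})"

definition Maslov_partition ::
  "(real \<Rightarrow> complex ^ 'n ^ 'n) \<Rightarrow> real \<Rightarrow> real \<Rightarrow> nat \<Rightarrow> (nat \<Rightarrow> real) \<Rightarrow> (nat \<Rightarrow> real) \<Rightarrow> bool" where
  "Maslov_partition W a b N t \<epsilon> \<longleftrightarrow>
     t 0 = a \<and> t N = b \<and> (\<forall>j\<in>{1..N}. t (j - 1) < t j) \<and>
     (\<forall>j\<in>{1..N}. 0 < \<epsilon> j \<and> \<epsilon> j < pi \<and>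
        (\<forall>s\<in>{t (j - 1)..t j}.
           cis (pi + \<epsilon> j) \<notin> mat_spectrum (W s) \<and> cis (pi - \<epsilon> j) \<notin> mat_spectrum (W s) \<and>
           finite {\<theta>. 0 \<le> \<theta> \<and> \<theta> \<le> \<epsilon> j \<and> cis (pi + \<theta>) \<in> mat_spectrum (W s)}))"

definition Maslov_sum ::
  "(real \<Rightarrow> complex ^ 'n ^ 'n) \<Rightarrow> nat \<Rightarrow> (nat \<Rightarrow> real) \<Rightarrow> (nat \<Rightarrow> real) \<Rightarrow> int" where
  "Maslov_sum W N t \<epsilon> =
     (\<Sum>j = 1..N. int (crossing_count (W (t j)) (\<epsilon> j)) - int (crossing_count (W (t (j - 1))) (\<epsilon> j)))"

text \<open>The common value of the sums over all admissible partitions.\<close>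

definition Mas ::
  "(real \<Rightarrow> (real ^ ('n::finite + 'n)) set \<times> (real ^ ('n + 'n)) set) \<Rightarrow> real \<Rightarrow> real \<Rightarrow> int" where
  "Mas L a b =
     (THE m. \<exists>N t \<epsilon>. Maslov_partition (\<lambda>s. W_tilde (L s)) a b N t \<epsilon> \<and>
                    m = Maslov_sum (\<lambda>s. W_tilde (L s)) N t \<epsilon>)"

end

theory Submission
  imports Defs "HOL-Computational_Algebra.Fundamental_Theorem_Algebra"
begin

text \<open>
  A unitary matrix is diagonalizable, so \<open>\<epsilon>\<close>-crossings can be counted on its eigenvalues
  \<open>exp (i (\<pi> + \<theta>\<^sub>j))\<close>, \<open>\<theta>\<^sub>j \<in> [0, 2\<pi>)\<close>. As long as \<open>exp (i (\<pi> + \<epsilon>))\<close> is not an eigenvalue, adding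
  \<open>2\<pi>\<close> to the angles below \<open>\<epsilon>\<close> makes their sum a continuous argument of the determinant.
  Hence, for any continuous logarithm \<open>g\<close> of \<open>det W\<close>, the number \<open>2\<pi> Mas\<close> is the increment
  of \<open>Im g - \<Sum>\<^sub>j \<theta>\<^sub>j\<close>, independently of the partition. On the rectangle of a homotopy
  \<open>det W\<close> has a continuous logarithm, which is constant on the two sides where the endpoints
  are fixed, so both boundary paths have the same increment.

  Identify \<open>\<real>\<^sup>2\<^sup>n\<close> with \<open>\<complex>\<^sup>n\<close> so that \<open>J\<close> becomes multiplication by \<open>i\<close>. The reflection in a
  Lagrangian subspace \<open>l\<close> anticommutes with \<open>J\<close>, hence equals \<open>U(l)\<close> composed with complex
  conjugation for a unitary \<open>U(l)\<close>, and \<open>W = - U(l\<^sub>1) cnj U(l\<^sub>2)\<close>. So \<open>W\<close> is unitary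
  and depends continuously on the orthogonal projections.
\<close>

subsection \<open>Diagonalization of unitary matrices\<close>

text \<open>Among the nonzero polynomials \<open>p\<close> with p(A) w = 0 take one of least degree
  and split off a root: p = (X - z) q. By minimality q(A) w is nonzero, so it is an eigenvector for
  \<open>z\<close>; it lies in \<open>T\<close> because \<open>T\<close> is invariant.\<close>

lemma eigenvector_in_invariant_subspace:
  fixes A :: "complex ^ 'n ^ 'n"
  assumes T: "vec.subspace T" and inv: "\<And>v. v \<in> T \<Longrightarrow> A *v v \<in> T"
    and w: "w \<in> T" "w \<noteq> 0"
  obtains z v where "v \<in> T" "v \<noteq> 0" "A *v v = z *s v"
proof -
  \<comment> \<open>\<open>ap p\<close> is p(A) w, evaluated by the Horner scheme.\<close>
  define ap where "ap = (\<lambda>p. fold_coeffs (\<lambda>a v. a *s w + A *v v) p 0)"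
  have ap_0 [simp]: "ap 0 = 0" by (simp add: ap_def)
  have ap_pCons [simp]: "ap (pCons a p) = a *s w + A *v ap p" for a p
    by (cases "a = 0 \<and> p = 0") (auto simp: ap_def)
  have ap_add: "ap (p + q) = ap p + ap q" for p q
    by (induction p q rule: poly_induct2)
      (simp_all add: vec.scale_left_distrib matrix_vector_right_distrib)
  have ap_smult: "ap (smult c p) = c *s ap p" for c p
    by (induction p) (simp_all add: vec.scale_right_distrib vector_scalar_commute)
  have ap_T: "ap p \<in> T" for p
    by (induction p) (simp_all add: vec.subspace_0[OF T] vec.subspace_add[OF T]
        vec.subspace_scale[OF T] w inv)
  have ap_sum: "ap (sum f I) = (\<Sum>i\<in>I. ap (f i))" if "finite I" for f and I :: "nat set"
    using that by (induction I) (simp_all add: ap_add)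
  define K where "K = (\<lambda>i::nat. ap (monom 1 i))"
  have monom: "ap (monom c i) = c *s K i" for c i
    using ap_smult[of c "monom 1 i"] by (simp add: K_def smult_monom)
  have "\<exists>p. p \<noteq> 0 \<and> ap p = 0"
  proof (cases "inj_on K {..CARD('n)}")
    \<comment> \<open>Equal Krylov vectors would merge in the set \<open>S\<close> below, so a
      coincidence is turned directly into a difference of two monomials.\<close>
    case False
    then obtain i j where ij: "i \<noteq> j" "K i = K j" by (auto simp: inj_on_def)
    have "ap (monom 1 i + monom (-1) j) = 0"
      using ij by (simp add: ap_add monom)
    moreover have "coeff (monom (1::complex) i + monom (-1) j) i \<noteq> 0" using ij by simp
    then have "monom (1::complex) i + monom (-1) j \<noteq> 0" by (metis coeff_0)
    ultimately show ?thesis by blast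
  next
    case True
    define S where "S = K ` {..CARD('n)}"
    have "card S = Suc CARD('n)" using True by (simp add: S_def card_image)
    then have "vec.dependent S"
      using vec.independent_card_le_dim[of S UNIV] by (auto simp: card_cart_basis)
    then obtain u where u: "\<exists>v\<in>S. u v \<noteq> 0" "(\<Sum>v\<in>S. u v *s v) = 0"
      using vec.dependent_finite[of S] by (auto simp: S_def)
    define p where "p = (\<Sum>i\<le>CARD('n). monom (u (K i)) i)"
    have "ap p = 0"
      using u(2) True by (simp add: p_def ap_sum monom S_def sum.reindex)
    moreover from u(1) obtain i where i: "i \<le> CARD('n)" "u (K i) \<noteq> 0" by (auto simp: S_def)
    then have "coeff p i \<noteq> 0"
      by (simp add: p_def coeff_sum)
    then have "p \<noteq> 0" by auto
    ultimately show ?thesis by blast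
  qed
  then obtain p where p: "p \<noteq> 0" "ap p = 0"
    and min: "\<And>q. q \<noteq> 0 \<and> ap q = 0 \<Longrightarrow> degree p \<le> degree q"
    using ex_has_least_nat[of "\<lambda>p. p \<noteq> 0 \<and> ap p = 0" _ degree] by blast
  have "degree p \<noteq> 0"
  proof
    assume "degree p = 0"
    then obtain c where "p = [:c:]" by (meson degree_eq_zeroE)
    then show False using p w by simp
  qed
  then have "\<not> constant (poly p)" by (simp add: constant_degree)
  then obtain z where "poly p z = 0" using fundamental_theorem_of_algebra by blast
  then obtain q where q: "p = [:-z, 1:] * q" by (metis dvdE poly_eq_0_iff_dvd)
  then have "q \<noteq> 0" using p by auto
  moreover have "degree p = Suc (degree q)"
    unfolding q using \<open>q \<noteq> 0\<close> by (subst degree_mult_eq) auto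
  ultimately have nz: "ap q \<noteq> 0" using min[of q] by fastforce
  have "p = smult (-z) q + pCons 0 q" by (simp add: q)
  then have "ap p = - z *s ap q + A *v ap q" by (simp only: ap_add ap_smult) simp
  with p have "A *v ap q = z *s ap q"
    by (simp add: eq_neg_iff_add_eq_0)
  then show thesis using that nz ap_T by blast
qed

definition diag_mat :: "('n \<Rightarrow> complex) \<Rightarrow> complex ^ 'n ^ 'n" where
  "diag_mat d = (\<chi> i j. if i = j then d i else 0)"

text \<open>An invertible \<open>P\<close> suffices, since only determinants, spectra and kernel
  dimensions are read off. Indexing \<open>d\<close> by \<open>'n\<close> records multiplicities as
  the sizes of its fibres.\<close>

definition diagonalizes :: "complex ^ 'n ^ 'n \<Rightarrow> ('n \<Rightarrow> complex) \<Rightarrow> bool" where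
  "diagonalizes A d \<longleftrightarrow> (\<exists>P. invertible P \<and> A ** P = P ** diag_mat d)"

text \<open>The inner product on complex vectors is the real one, the real part of the Hermitian
  form.\<close>

lemma inner_vector_scalar_mult_right:
  fixes x y :: "complex ^ 'n"
  shows "x \<bullet> (c *s y) = (cnj c *s x) \<bullet> y"
  unfolding inner_vec_def by (intro sum.cong refl) (simp add: inner_complex_def algebra_simps)

lemma norm_vector_scalar_mult_complex: "norm (c *s (v :: complex ^ 'n)) = cmod c * norm v"
  unfolding norm_vec_def by (simp add: norm_mult L2_set_right_distrib)

lemma scaleR_eq_vector_scalar_mult: "r *\<^sub>R (v :: complex ^ 'n) = of_real r *s v"
  by (vector scaleR_conv_of_real)

lemma linear_complex_matrix: "linear (\<lambda>v. (A :: complex ^ 'n ^ 'n) *v v)"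
  by (rule linearI)
    (simp_all add: matrix_vector_right_distrib scaleR_eq_vector_scalar_mult vector_scalar_commute)

text \<open>If the eigenvectors did not span, their orthogonal complement would be a nonzero
  invariant complex subspace. An eigenvector inside it would be orthogonal to itself. Hence a basis
  can be chosen among the eigenvectors.\<close>

lemma isometry_diagonalizable:
  fixes A :: "complex ^ 'n ^ 'n"
  assumes iso: "\<And>v. norm (A *v v) = norm v"
  obtains d where "diagonalizes A d"
proof -
  define E where "E = {v. \<exists>z. A *v v = z *s v}"
  have E_scale: "c *s v \<in> E" if "v \<in> E" for c v
    using that by (auto simp: E_def vector_scalar_commute vector_smult_assoc mult.commute)
  have spanE: "vec.span E = UNIV"
  proof (rule ccontr)
    assume "vec.span E \<noteq> UNIV"
    then obtain x where x: "x \<notin> vec.span E" by blast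
    \<comment> \<open>The orthogonal decomposition concerns real subspaces, so the complex span is
      first regarded as a real one.\<close>
    have sub: "subspace (vec.span E)"
      unfolding subspace_def scaleR_eq_vector_scalar_mult
      by (simp add: vec.span_zero vec.span_add vec.span_scale)
    obtain y w where yw: "y \<in> span (vec.span E)" "\<And>z. z \<in> span (vec.span E) \<Longrightarrow> orthogonal w z" "x = y + w"
      using orthogonal_subspace_decomp_exists[of "vec.span E" x] by blast
    have "span (vec.span E) = vec.span E" using sub by (simp only: span_eq_iff)
    with yw x have w: "w \<noteq> 0" "\<And>z. z \<in> E \<Longrightarrow> z \<bullet> w = 0"
      by (auto simp: vec.span_base orthogonal_def inner_commute)
    \<comment> \<open>Although defined by the real inner product, \<open>T\<close> is a complex
      subspace, because \<open>E\<close> is closed under complex scaling.\<close>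
    define T where "T = {v. \<forall>e\<in>E. e \<bullet> v = 0}"
    have T: "vec.subspace T"
      unfolding vec.subspace_def T_def
      by (auto simp: inner_add_right inner_vector_scalar_mult_right E_scale)
    have "orthogonal_transformation (\<lambda>v. A *v v)"
      by (simp add: orthogonal_transformation linear_complex_matrix iso)
    then have AA: "(A *v u) \<bullet> (A *v v) = u \<bullet> v" for u v
      by (simp add: orthogonal_transformation_def)
    have inv: "A *v v \<in> T" if "v \<in> T" for v
      unfolding T_def
    proof (safe)
      fix e assume e: "e \<in> E"
      then obtain z where z: "A *v e = z *s e" by (auto simp: E_def)
      show "e \<bullet> (A *v v) = 0"
      proof (cases "e = 0")
        case False
        have "cmod z * norm e = norm e" using iso[of e] by (simp add: z norm_vector_scalar_mult_complex)
        then have "z \<noteq> 0" using False by auto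
        \<comment> \<open>Writing \<open>e\<close> as an image under \<open>A\<close> allows the
          isometry to be cancelled on both sides of the inner product.\<close>
        then have "A *v (inverse z *s e) = e"
          by (simp add: vector_scalar_commute z vector_smult_assoc)
        then have "e \<bullet> (A *v v) = (inverse z *s e) \<bullet> v" by (metis AA)
        also have "\<dots> = 0" using that E_scale[OF e] by (auto simp: T_def)
        finally show ?thesis .
      qed simp
    qed
    have "w \<in> T" using w by (simp add: T_def)
    then obtain z v where "v \<in> T" "v \<noteq> 0" "A *v v = z *s v"
      using eigenvector_in_invariant_subspace[OF T inv] w(1) by metis
    then show False by (auto simp: T_def E_def)
  qed
  obtain B where B: "B \<subseteq> E" "vec.independent B" "E \<subseteq> vec.span B" "card B = vec.dim E"
    using vec.basis_exists[of E] by blast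
  have spanB: "vec.span B = UNIV"
    using vec.span_mono[OF B(3)] spanE by (auto simp: vec.span_span)
  have "card B = CARD('n)"
    using B(4) spanE vec_dim_card vec.dim_span by metis
  moreover have "finite B" using B(2) by (rule vec.finiteI_independent)
  ultimately obtain h where h: "bij_betw h (UNIV :: 'n set) B"
    using finite_same_card_bij[of "UNIV :: 'n set" B] by auto
  have "\<exists>z. A *v h j = z *s h j" for j
    using h B(1) by (auto simp: bij_betw_def E_def)
  then obtain d where d: "\<And>j. A *v h j = d j *s h j" by metis
  define P where "P = (\<chi> i j. h j $ i)"
  have "columns P = B"
    using h by (auto simp: columns_def column_def P_def bij_betw_def)
  then have "invertible P"
    using matrix_right_invertible_span_columns[of P] spanB by (auto simp: invertible_right_inverse)
  moreover have "A ** P = P ** diag_mat d"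
  proof -
    have "(A ** P) $ i $ j = (P ** diag_mat d) $ i $ j" for i j
    proof -
      have "(A ** P) $ i $ j = (A *v h j) $ i"
        by (simp add: matrix_matrix_mult_def matrix_vector_mult_def P_def)
      also have "\<dots> = (P ** diag_mat d) $ i $ j"
        by (simp add: d matrix_matrix_mult_def diag_mat_def P_def if_distrib cong: if_cong)
      finally show ?thesis .
    qed
    then show ?thesis by (simp add: vec_eq_iff)
  qed
  ultimately show thesis using that by (auto simp: diagonalizes_def)
qed

text \<open>This is x I + y A. It covers both the characteristic matrix \<open>A - mat z\<close> and
  the segment from I to a multiple of \<open>A\<close>, so one determinant formula serves
  both.\<close>

definition affine_mat :: "complex \<Rightarrow> complex \<Rightarrow> complex ^ 'n ^ 'n \<Rightarrow> complex ^ 'n ^ 'n" where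
  "affine_mat x y A = (\<chi> i j. (if i = j then x else 0) + y * A $ i $ j)"

lemma affine_mat_mult_left: "(affine_mat x y A ** P) $ i $ j = x * P $ i $ j + y * (A ** P) $ i $ j"
proof -
  have "(affine_mat x y A ** P) $ i $ j
      = (\<Sum>k\<in>UNIV. (if k = i then x * P $ k $ j else 0) + y * (A $ i $ k * P $ k $ j))"
    unfolding matrix_matrix_mult_def affine_mat_def by (auto intro!: sum.cong simp: algebra_simps)
  then show ?thesis
    by (simp add: sum.distrib sum_distrib_left matrix_matrix_mult_def)
qed

lemma affine_mat_mult_right: "(P ** affine_mat x y A) $ i $ j = x * P $ i $ j + y * (P ** A) $ i $ j"
proof -
  have "(P ** affine_mat x y A) $ i $ j
      = (\<Sum>k\<in>UNIV. (if k = j then x * P $ i $ k else 0) + y * (P $ i $ k * A $ k $ j))"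
    unfolding matrix_matrix_mult_def affine_mat_def by (auto intro!: sum.cong simp: algebra_simps)
  then show ?thesis
    by (simp add: sum.distrib sum_distrib_left matrix_matrix_mult_def)
qed

lemma det_affine_mat:
  assumes "diagonalizes A d"
  shows "det (affine_mat x y A) = (\<Prod>j\<in>UNIV. x + y * d j)"
proof -
  obtain P where P: "invertible P" "A ** P = P ** diag_mat d"
    using assms by (auto simp: diagonalizes_def)
  have "affine_mat x y A ** P = P ** affine_mat x y (diag_mat d)"
    by (simp add: vec_eq_iff affine_mat_mult_left affine_mat_mult_right P)
  then have "det (affine_mat x y A) * det P = det P * det (affine_mat x y (diag_mat d))"
    by (metis det_mul)
  then have "det (affine_mat x y A) = det (affine_mat x y (diag_mat d))"
    using P(1) by (simp add: invertible_det_nz)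
  also have "\<dots> = (\<Prod>j\<in>UNIV. x + y * d j)"
    by (subst det_diagonal) (simp_all add: affine_mat_def diag_mat_def)
  finally show ?thesis .
qed

section \<open>Spectrum and eigenspaces in terms of the diagonal entries\<close>

lemma diff_mat_eq_affine: "A - mat z = affine_mat (- z) 1 A"
  by (auto simp: vec_eq_iff affine_mat_def mat_def)

lemma mat_spectrum_eq_det: "z \<in> mat_spectrum A \<longleftrightarrow> det (affine_mat (- z) 1 A) = 0"
  by (simp add: mat_spectrum_def invertible_det_nz diff_mat_eq_affine)

lemma mat_spectrum_diagonalizes:
  assumes "diagonalizes A d"
  shows "mat_spectrum A = range d"
  by (auto simp: mat_spectrum_eq_det det_affine_mat[OF assms])

text \<open>\<open>P\<close> maps the corresponding kernel for the diagonal matrix, a coordinate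
  subspace, bijectively onto this kernel.\<close>

lemma dim_eigenspace_diagonalizes:
  fixes A :: "complex ^ 'n ^ 'n"
  assumes "diagonalizes A d"
  shows "vec.dim {v. (A - mat z) *v v = 0} = card {j. d j = z}"
proof -
  obtain P where P: "invertible P" "A ** P = P ** diag_mat d"
    using assms by (auto simp: diagonalizes_def)
  have inj: "inj (\<lambda>u. P *v u)" and surj: "surj (\<lambda>u. P *v u)"
    using P(1) by (simp_all add: invertible_eq_bij bij_def)
  have AP: "(A - mat z) ** P = P ** (diag_mat d - mat z)"
    unfolding diff_mat_eq_affine
    by (simp add: vec_eq_iff affine_mat_mult_left affine_mat_mult_right P)
  have D: "(diag_mat d - mat z) *v u = (\<chi> j. (d j - z) * u $ j)" for u
  proof -
    have "(diag_mat d - mat z) $ i $ j * u $ j = (if j = i then (d j - z) * u $ j else 0)" for i j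
      by (simp add: diag_mat_def mat_def)
    then show ?thesis
      by (simp add: vec_eq_iff matrix_vector_mult_def)
  qed
  have "{v. (A - mat z) *v v = 0} = (\<lambda>u. P *v u) ` {u. (A - mat z) *v (P *v u) = 0}"
    (is "?K = _")
  proof (intro equalityI subsetI)
    fix v assume "v \<in> ?K"
    moreover obtain u where "v = P *v u" using surj by (metis surjD)
    ultimately show "v \<in> (\<lambda>u. P *v u) ` {u. (A - mat z) *v (P *v u) = 0}" by simp
  qed auto
  also have "{u. (A - mat z) *v (P *v u) = 0} = {u. P *v ((diag_mat d - mat z) *v u) = P *v 0}"
    by (simp add: matrix_vector_mul_assoc AP)
  also have "\<dots> = {u. \<forall>j. j \<notin> {j. d j = z} \<longrightarrow> u $ j = 0}"
    unfolding inj_eq[OF inj] D by (auto simp: vec_eq_iff)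
  finally have "vec.dim {v. (A - mat z) *v v = 0}
     = vec.dim ((\<lambda>u. P *v u) ` {u. \<forall>j. j \<notin> {j. d j = z} \<longrightarrow> u $ j = 0})" by simp
  also have "\<dots> = vec.dim {u::complex^'n. \<forall>j. j \<notin> {j. d j = z} \<longrightarrow> u $ j = 0}"
    by (rule vec.dim_image_eq[OF matrix_vector_mul_linear_gen]) (use inj inj_on_subset in blast)
  also have "\<dots> = card {j. d j = z}" by (rule dim_substandard_cart)
  finally show ?thesis .
qed

lemma norm_eigenvalue_isometry:
  fixes A :: "complex ^ 'n ^ 'n"
  assumes iso: "\<And>v. norm (A *v v) = norm v" and "diagonalizes A d"
  shows "cmod (d j) = 1"
proof -
  have "d j \<in> mat_spectrum A" using mat_spectrum_diagonalizes[OF assms(2)] by auto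
  then have "\<not> (\<forall>v. (A - mat (d j)) *v v = 0 \<longrightarrow> v = 0)"
    by (simp add: mat_spectrum_def invertible_left_inverse matrix_left_invertible_ker)
  then obtain v where v: "v \<noteq> 0" "(A - mat (d j)) *v v = 0" by blast
  then have "A *v v = mat (d j) *v v" by (simp add: matrix_vector_mult_diff_rdistrib)
  also have "\<dots> = d j *s v"
    by (simp add: vec_eq_iff matrix_vector_mult_def mat_def if_distrib if_distribR cong: if_cong)
  finally have "cmod (d j) * norm v = norm v" using iso[of v] by (simp add: norm_vector_scalar_mult_complex)
  then show ?thesis using v by simp
qed

text \<open>Angles are measured counterclockwise from -1, which is why the argument is taken of
  \<open>- z\<close>.\<close>

lemma cis_pi_plus_eq_iff_Arg2pi:
  assumes "cmod z = 1" "0 \<le> \<theta>" "\<theta> < 2 * pi"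
  shows "z = cis (pi + \<theta>) \<longleftrightarrow> Arg2pi (- z) = \<theta>"
proof
  assume "z = cis (pi + \<theta>)"
  then have "- z = of_real 1 * exp (\<i> * \<theta>)" by (simp add: cis_conv_exp[symmetric] cis_mult[symmetric])
  then show "Arg2pi (- z) = \<theta>" using assms Arg2pi_unique[of 1 \<theta> "- z"] by simp
next
  assume "Arg2pi (- z) = \<theta>"
  then have "- z = exp (\<i> * \<theta>)" using Arg2pi_eq[of "- z"] assms by simp
  then have "z = - cis \<theta>" by (simp add: cis_conv_exp minus_equation_iff[of z])
  then show "z = cis (pi + \<theta>)" by (simp add: cis_mult[symmetric])
qed

text \<open>The kernel at angle \<theta> contributes the number of indices with that angle. These
  index sets are disjoint for different \<theta>, so the sum is the cardinality of their
  union.\<close>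

lemma crossing_count_diagonalizes:
  fixes A :: "complex ^ 'n ^ 'n"
  assumes "diagonalizes A d" and d1: "\<And>j. cmod (d j) = 1" and "\<epsilon> < 2 * pi"
  shows "crossing_count A \<epsilon> = card {j. Arg2pi (- d j) < \<epsilon>}"
proof -
  define \<Theta> where "\<Theta> = {\<theta>. 0 \<le> \<theta> \<and> \<theta> < \<epsilon> \<and> cis (pi + \<theta>) \<in> mat_spectrum A}"
  have iff: "d j = cis (pi + \<theta>) \<longleftrightarrow> Arg2pi (- d j) = \<theta>" if "\<theta> \<in> \<Theta>" for j \<theta>
    using that assms by (intro cis_pi_plus_eq_iff_Arg2pi) (auto simp: \<Theta>_def)
  have "cis (pi + Arg2pi (- d j)) = d j" for j
    using cis_pi_plus_eq_iff_Arg2pi[OF d1[of j] Arg2pi_ge_0 Arg2pi_lt_2pi, of "- d j"] by simp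
  then have range: "Arg2pi (- d j) \<in> \<Theta>" if "Arg2pi (- d j) < \<epsilon>" for j
    using that by (simp add: \<Theta>_def mat_spectrum_diagonalizes[OF assms(1)] Arg2pi_ge_0)
  have sub: "\<Theta> \<subseteq> range (\<lambda>j. Arg2pi (- d j))"
  proof
    fix \<theta> assume \<theta>: "\<theta> \<in> \<Theta>"
    then obtain j where "d j = cis (pi + \<theta>)"
      by (auto simp: \<Theta>_def mat_spectrum_diagonalizes[OF assms(1)])
    then show "\<theta> \<in> range (\<lambda>j. Arg2pi (- d j))" using iff[OF \<theta>] by auto
  qed
  then have "finite \<Theta>" by (rule finite_subset) simp
  have "crossing_count A \<epsilon> = (\<Sum>\<theta>\<in>\<Theta>. card {j. Arg2pi (- d j) = \<theta>})"
    unfolding crossing_count_def \<Theta>_def[symmetric] dim_eigenspace_diagonalizes[OF assms(1)]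
    by (intro sum.cong refl arg_cong[of _ _ card]) (simp add: iff)
  also have "\<dots> = card (\<Union>\<theta>\<in>\<Theta>. {j. Arg2pi (- d j) = \<theta>})"
    using \<open>finite \<Theta>\<close> by (subst card_UN_disjoint) auto
  also have "(\<Union>\<theta>\<in>\<Theta>. {j. Arg2pi (- d j) = \<theta>}) = {j. Arg2pi (- d j) < \<epsilon>}"
    using range by (auto simp: \<Theta>_def)
  finally show ?thesis .
qed

subsection \<open>Spectral flow and the determinant\<close>

lemma continuous_on_det:
  fixes A :: "'a::topological_space \<Rightarrow> complex ^ 'n ^ 'n"
  assumes "\<And>i j. continuous_on S (\<lambda>p. A p $ i $ j)"
  shows "continuous_on S (\<lambda>p. det (A p))"
  unfolding det_def by (intro continuous_on_sum continuous_on_mult continuous_on_const continuous_on_prod assms)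

lemma continuous_on_det_affine_mat:
  fixes A :: "'a::topological_space \<Rightarrow> complex ^ 'n ^ 'n"
  assumes "continuous_on S x" "continuous_on S y" "\<And>i j. continuous_on S (\<lambda>p. A p $ i $ j)"
  shows "continuous_on S (\<lambda>p. det (affine_mat (x p) (y p) (A p)))"
proof (rule continuous_on_det)
  fix i j
  show "continuous_on S (\<lambda>p. affine_mat (x p) (y p) (A p) $ i $ j)"
    by (cases "i = j") (auto simp: affine_mat_def intro!: continuous_intros assms)
qed

text \<open>The values of \<open>f - g\<close> differ by multiples of 2 pi i, and a continuous
  function with discrete range is constant on an interval. The factor \<open>k\<close> allows
  functions that are proportional rather than equal.\<close>

lemma continuous_logarithms_diff:
  fixes f g :: "real \<Rightarrow> complex"
  assumes "c \<le> d" "continuous_on {c..d} f" "continuous_on {c..d} g"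
    and exp: "\<And>t. t \<in> {c..d} \<Longrightarrow> exp (f t) = k * exp (g t)"
  shows "f d - f c = g d - g c"
proof -
  have "\<exists>e>0. \<forall>t. t \<in> {c..d} \<and> f t - g t \<noteq> f s - g s \<longrightarrow> e \<le> norm ((f t - g t) - (f s - g s))"
    if s: "s \<in> {c..d}" for s
  proof (intro exI[of _ "2 * pi"] conjI allI impI)
    fix t assume t: "t \<in> {c..d} \<and> f t - g t \<noteq> f s - g s"
    have "exp (f t - g t) = exp (f s - g s)" using exp[of t] exp[of s] s t by (simp add: exp_diff)
    then obtain n :: int where n: "f t - g t = f s - g s + of_int (2 * n) * pi * \<i>"
      using exp_eq[of "f t - g t" "f s - g s"] by auto
    with t have "n \<noteq> 0" by auto
    then have "1 \<le> \<bar>real_of_int n\<bar>" by linarith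
    then have "2 * pi \<le> 2 * \<bar>real_of_int n\<bar> * pi" by simp
    also have "\<dots> = norm ((f t - g t) - (f s - g s))" using n by (simp add: norm_mult)
    finally show "2 * pi \<le> norm ((f t - g t) - (f s - g s))" .
  qed simp
  then have "(\<lambda>t. f t - g t) constant_on {c..d}"
    by (intro continuous_discrete_range_constant continuous_intros assms) auto
  then have "f d - g d = f c - g c" using \<open>c \<le> d\<close> unfolding constant_on_def by (metis atLeastAtMost_iff order_refl)
  then show ?thesis by (simp add: algebra_simps)
qed

text \<open>A segment from 1 to a point of the unit circle meets the branch cut of \<open>Ln\<close>
  only if that point is -1.\<close>

lemma convex_comb_unit_notin_nonpos_Reals:
  assumes "cmod \<mu> = 1" "\<mu> \<noteq> -1" "0 \<le> s" "s \<le> 1"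
  shows "of_real (1 - s) + of_real s * \<mu> \<notin> \<real>\<^sub>\<le>\<^sub>0"
proof
  assume "of_real (1 - s) + of_real s * \<mu> \<in> \<real>\<^sub>\<le>\<^sub>0"
  then obtain r where r: "of_real (1 - s) + of_real s * \<mu> = of_real r" "r \<le> 0"
    by (auto elim: nonpos_Reals_cases)
  then have eq: "of_real s * \<mu> = of_real (r - (1 - s))" by (simp add: algebra_simps)
  have "s = cmod (of_real s * \<mu>)" using assms by (simp add: norm_mult)
  also have "\<dots> = (1 - s) - r" unfolding eq norm_of_real using assms r by simp
  finally have s: "r - (1 - s) = - s" by simp
  then have "of_real s * \<mu> = of_real s * (-1)" unfolding eq s by simp
  moreover have "s \<noteq> 0" using s r by auto
  ultimately have "\<mu> = -1" using mult_left_cancel[of "of_real s" \<mu> "-1"] by simp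
  then show False using \<open>\<mu> \<noteq> -1\<close> by simp
qed

text \<open>The choice, and hence the labelling, is arbitrary for each matrix. Along a path single
  entries need not vary continuously; only symmetric expressions in them are followed.\<close>

definition eigenvalues :: "complex ^ 'n ^ 'n \<Rightarrow> 'n \<Rightarrow> complex" where
  "eigenvalues A = (SOME d. diagonalizes A d)"

text \<open>This may jump when an eigenvalue passes through -1; adding 2 pi times the crossing count
  compensates for such jumps.\<close>

definition angle_sum :: "complex ^ 'n ^ 'n \<Rightarrow> real" where
  "angle_sum A = (\<Sum>j\<in>UNIV. Arg2pi (- eigenvalues A j))"

lemma diagonalizes_eigenvalues:
  fixes A :: "complex ^ 'n ^ 'n"
  assumes "\<And>v. norm (A *v v) = norm v"
  shows "diagonalizes A (eigenvalues A)" "cmod (eigenvalues A j) = 1"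
proof -
  obtain d where "diagonalizes A d" using isometry_diagonalizable[of A] assms by blast
  then show *: "diagonalizes A (eigenvalues A)" unfolding eigenvalues_def by (rule someI[of "diagonalizes A"])
  show "cmod (eigenvalues A j) = 1" by (rule norm_eigenvalue_isometry[OF assms *])
qed

text \<open>Rotation by \<open>- \<epsilon>\<close> moves the point at angle \<epsilon> onto the
  branch cut of \<open>Ln\<close>. Angles below \<epsilon> then need an extra 2 pi to land in the
  principal range, and the lower end \<open>- pi\<close> is excluded because the angle differs from
  \<epsilon>.\<close>

lemma Ln_rotated:
  assumes "cmod z = 1" "0 \<le> \<epsilon>" "\<epsilon> < 2 * pi" "Arg2pi (- z) \<noteq> \<epsilon>"
  shows "Ln (cis (- \<epsilon>) * z)
    = \<i> * of_real (Arg2pi (- z) + (if Arg2pi (- z) < \<epsilon> then 2 * pi else 0) - \<epsilon> - pi)"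
    (is "_ = \<i> * of_real ?\<tau>")
proof -
  have "- z = cis (Arg2pi (- z))"
    using Arg2pi_eq[of "- z"] assms(1) by (simp add: cis_conv_exp)
  then have z: "z = - cis (Arg2pi (- z))" by (simp add: minus_equation_iff[of z])
  have "exp (\<i> * of_real ?\<tau>) = cis ?\<tau>" by (simp add: cis_conv_exp)
  also have "\<dots> = cis (- \<epsilon>) * (cis (- pi) * (cis (Arg2pi (- z)) * cis (if Arg2pi (- z) < \<epsilon> then 2 * pi else 0)))"
    unfolding cis_mult by (rule arg_cong[of _ _ cis]) simp
  also have "\<dots> = cis (- \<epsilon>) * - cis (Arg2pi (- z))"
    by (simp add: cis.code complex_eq_iff)
  also have "\<dots> = cis (- \<epsilon>) * z" using z by simp
  finally have "cis (- \<epsilon>) * z = exp (\<i> * of_real ?\<tau>)" by simp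
  moreover have "Ln (exp (\<i> * of_real ?\<tau>)) = \<i> * of_real ?\<tau>"
    using assms Arg2pi_ge_0[of "- z"] Arg2pi_lt_2pi[of "- z"]
    by (intro Ln_exp) (auto split: if_splits)
  ultimately show ?thesis by simp
qed

text \<open>Eigenvalues cannot be followed individually in \<open>t\<close>, so the increment of
  \<open>g\<close> is computed around a rectangle: it equals the difference of increments along two
  vertical edges, where \<open>t\<close> is fixed and the eigenvalues can be used one by
  one.\<close>

lemma log_det_increment:
  fixes W :: "real \<Rightarrow> complex ^ 'n ^ 'n"
  assumes "c \<le> d" and iso: "\<And>t v. t \<in> {c..d} \<Longrightarrow> norm (W t *v v) = norm v"
    and contW: "\<And>i j. continuous_on {c..d} (\<lambda>t. W t $ i $ j)"
    and contg: "continuous_on {c..d} g" and g: "\<And>t. t \<in> {c..d} \<Longrightarrow> exp (g t) = det (W t)"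
    and eps: "0 \<le> \<epsilon>" "\<epsilon> < 2 * pi" "\<And>t. t \<in> {c..d} \<Longrightarrow> cis (pi + \<epsilon>) \<notin> mat_spectrum (W t)"
  shows "g d - g c = \<i> * of_real
     ((angle_sum (W d) + 2 * pi * real (crossing_count (W d) \<epsilon>))
      - (angle_sum (W c) + 2 * pi * real (crossing_count (W c) \<epsilon>)))"
proof -
  let ?e = "\<lambda>t. eigenvalues (W t)"
  \<comment> \<open>The segment from \<open>I\<close> to \<open>exp (- i \<epsilon>) W t\<close> consists of invertible matrices, as \<open>-1\<close> is not an
    eigenvalue of its endpoint; a logarithm of \<open>D\<close> increases along it by the sum of the principal
    logarithms of the eigenvalues.\<close>
  define D where "D = (\<lambda>(t, s). det (affine_mat (of_real (1 - s)) (of_real s * cis (- \<epsilon>)) (W t)))"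
  have diag: "diagonalizes (W t) (?e t)" and norm1: "cmod (?e t j) = 1" if "t \<in> {c..d}" for t j
    using diagonalizes_eigenvalues[of "W t"] iso[OF that] by blast+
  have D: "D (t, s) = (\<Prod>j\<in>UNIV. of_real (1 - s) + of_real s * (cis (- \<epsilon>) * ?e t j))" if "t \<in> {c..d}" for t s
    by (simp add: D_def det_affine_mat[OF diag[OF that]] mult.assoc)
  have ne: "Arg2pi (- ?e t j) \<noteq> \<epsilon>" if "t \<in> {c..d}" for t j
    using eps(3)[OF that] cis_pi_plus_eq_iff_Arg2pi[OF norm1[OF that, of j] eps(1,2)]
    by (auto simp: mat_spectrum_diagonalizes[OF diag[OF that]])
  have ne1: "cis (- \<epsilon>) * ?e t j \<noteq> -1" if "t \<in> {c..d}" for t j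
  proof
    assume "cis (- \<epsilon>) * ?e t j = -1"
    then have "cis \<epsilon> * (cis (- \<epsilon>) * ?e t j) = cis \<epsilon> * -1" by simp
    then have "?e t j = cis (pi + \<epsilon>)" by (simp add: mult.assoc[symmetric] cis_mult) (simp add: cis_mult[symmetric])
    then show False using ne[OF that, of j] cis_pi_plus_eq_iff_Arg2pi[OF norm1[OF that, of j] eps(1,2)] by simp
  qed
  have np: "of_real (1 - s) + of_real s * (cis (- \<epsilon>) * ?e t j) \<notin> \<real>\<^sub>\<le>\<^sub>0"
    if "t \<in> {c..d}" "s \<in> {0..1}" for t s j
    using that norm1 ne1 by (intro convex_comb_unit_notin_nonpos_Reals) (auto simp: norm_mult)
  then have nz: "of_real (1 - s) + of_real s * (cis (- \<epsilon>) * ?e t j) \<noteq> 0"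
    if "t \<in> {c..d}" "s \<in> {0..1}" for t s j
    using np[OF that, of j] by (metis nonpos_Reals_zero_I)
  let ?K = "{c..d} \<times> {0..1::real}"
  have contD: "continuous_on ?K D"
    unfolding D_def case_prod_unfold
    by (intro continuous_on_det_affine_mat continuous_intros continuous_on_compose2[OF contW continuous_on_fst])
      (auto intro: continuous_intros)
  obtain h where h: "continuous_on ?K h" "\<And>p. p \<in> ?K \<Longrightarrow> D p = exp (h p)"
  proof (rule continuous_logarithm_on_contractible[OF contD])
    show "contractible ?K" by (intro convex_imp_contractible convex_Times) auto
    show "D p \<noteq> 0" if "p \<in> ?K" for p
      using that nz by (cases p) (auto simp: D)
  qed (use that in blast)
  \<comment> \<open>For fixed \<open>t\<close> the sum of principal logarithms is continuous in
    \<open>s\<close>, as every factor avoids the branch cut; it vanishes at s = 0.\<close>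
  have vert: "h (t, 1) - h (t, 0) = (\<Sum>j\<in>UNIV. Ln (cis (- \<epsilon>) * ?e t j))" if t: "t \<in> {c..d}" for t
  proof -
    have "h (t, 1) - h (t, 0)
      = (\<Sum>j\<in>UNIV. Ln (of_real (1 - 1) + of_real 1 * (cis (- \<epsilon>) * ?e t j)))
       - (\<Sum>j\<in>UNIV. Ln (of_real (1 - 0) + of_real 0 * (cis (- \<epsilon>) * ?e t j)))"
    proof (rule continuous_logarithms_diff[where k = 1])
      show "continuous_on {0..1} (\<lambda>s. h (t, s))"
        by (rule continuous_on_compose2[OF h(1)]) (use t in \<open>auto intro!: continuous_intros\<close>)
      show "continuous_on {0..1} (\<lambda>s. \<Sum>j\<in>UNIV. Ln (of_real (1 - s) + of_real s * (cis (- \<epsilon>) * ?e t j)))"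
        using np[OF t] by (intro continuous_intros) auto
      fix s :: real assume s: "s \<in> {0..1}"
      have "exp (h (t, s)) = D (t, s)" using h(2) s t by simp
      also have "\<dots> = (\<Prod>j\<in>UNIV. exp (Ln (of_real (1 - s) + of_real s * (cis (- \<epsilon>) * ?e t j))))"
        unfolding D[OF t] using nz[OF t s] by (intro prod.cong refl) (simp del: of_real_diff)
      finally show "exp (h (t, s)) = 1 * exp (\<Sum>j\<in>UNIV. Ln (of_real (1 - s) + of_real s * (cis (- \<epsilon>) * ?e t j)))"
        by (simp add: exp_sum)
    qed simp
    then show ?thesis by simp
  qed
  \<comment> \<open>At s = 0 the matrix is the identity, so \<open>D\<close> is constantly
    1.\<close>
  have bottom: "h (d, 0) - h (c, 0) = 0 - 0"
  proof (rule continuous_logarithms_diff[where k = 1 and f = "\<lambda>t. h (t, 0)"])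
    show "continuous_on {c..d} (\<lambda>t. h (t, 0))"
      by (rule continuous_on_compose2[OF h(1)]) (auto intro!: continuous_intros)
    show "exp (h (t, 0)) = 1 * exp 0" if "t \<in> {c..d}" for t
      using h(2)[of "(t, 0)"] that by (simp add: D)
  qed (use \<open>c \<le> d\<close> in auto)
  \<comment> \<open>At s = 1 \<open>D\<close> is \<open>det (W t)\<close> times a constant power of
    \<open>cis (- \<epsilon>)\<close>, which is the factor \<open>k\<close>.\<close>
  have top: "h (d, 1) - h (c, 1) = g d - g c"
  proof (rule continuous_logarithms_diff[where f = "\<lambda>t. h (t, 1)"])
    show "continuous_on {c..d} (\<lambda>t. h (t, 1))"
      by (rule continuous_on_compose2[OF h(1)]) (auto intro!: continuous_intros)
    fix t assume t: "t \<in> {c..d}"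
    have "affine_mat 0 1 (W t) = W t" by (simp add: vec_eq_iff affine_mat_def)
    then have "det (W t) = (\<Prod>j\<in>UNIV. ?e t j)" using det_affine_mat[OF diag[OF t], of 0 1] by simp
    then show "exp (h (t, 1)) = cis (- \<epsilon>) ^ CARD('n) * exp (g t)"
      using h(2)[of "(t, 1)"] t by (simp add: D g prod.distrib)
  qed (use \<open>c \<le> d\<close> contg in auto)
  \<comment> \<open>The last summand does not depend on \<open>t\<close> and cancels between the two
    vertical edges.\<close>
  have sum: "(\<Sum>j\<in>UNIV. Ln (cis (- \<epsilon>) * ?e t j))
      = \<i> * of_real (angle_sum (W t) + 2 * pi * real (crossing_count (W t) \<epsilon>) - real CARD('n) * (\<epsilon> + pi))"
    if t: "t \<in> {c..d}" for t
  proof -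
    have "(\<Sum>j\<in>UNIV. Ln (cis (- \<epsilon>) * ?e t j)) = \<i> * of_real (\<Sum>j\<in>UNIV.
        Arg2pi (- ?e t j) + (if Arg2pi (- ?e t j) < \<epsilon> then 2 * pi else 0) - (\<epsilon> + pi))"
      unfolding of_real_sum sum_distrib_left
      by (intro sum.cong refl) (simp only: Ln_rotated[OF norm1[OF t] eps(1,2) ne[OF t]] diff_diff_eq)
    also have "(\<Sum>j\<in>UNIV. Arg2pi (- ?e t j) + (if Arg2pi (- ?e t j) < \<epsilon> then 2 * pi else 0) - (\<epsilon> + pi))
        = angle_sum (W t) + 2 * pi * real (crossing_count (W t) \<epsilon>) - real CARD('n) * (\<epsilon> + pi)"
      using crossing_count_diagonalizes[OF diag[OF t] norm1[OF t] eps(2)]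
      by (simp add: angle_sum_def sum.distrib sum_subtractf sum.If_cases mult.commute)
    finally show ?thesis .
  qed
  have "g d - g c = (h (d, 1) - h (d, 0)) - (h (c, 1) - h (c, 0))"
    using top bottom by (simp add: algebra_simps)
  then show ?thesis
    using \<open>c \<le> d\<close> by (simp add: vert sum algebra_simps)
qed

section \<open>Admissible partitions: their sums and their existence\<close>

lemma Maslov_partitionD:
  assumes "Maslov_partition W a b N t \<epsilon>" "j \<in> {1..N}"
  shows "t (j - 1) < t j" "0 < \<epsilon> j" "\<epsilon> j < pi"
    "s \<in> {t (j - 1)..t j} \<Longrightarrow> cis (pi + \<epsilon> j) \<notin> mat_spectrum (W s)"
  using assms unfolding Maslov_partition_def by blast+

lemma Maslov_partition_mono:
  assumes "Maslov_partition W a b N t \<epsilon>" "i \<le> j" "j \<le> N"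
  shows "t i \<le> t j"
  using assms(2,3)
proof (induction j rule: dec_induct)
  case (step j)
  then have "t (Suc j - 1) < t (Suc j)"
    by (intro Maslov_partitionD[OF assms(1)]) simp
  then show ?case using step by simp
qed simp

text \<open>On summing over the pieces the angle sums telescope, while the crossing counts, taken
  with a different \<epsilon> on each piece, form the Maslov sum. As the left side does not involve
  the partition, the sum is independent of it.\<close>

lemma log_det_increment_Maslov_sum:
  fixes W :: "real \<Rightarrow> complex ^ 'n ^ 'n"
  assumes part: "Maslov_partition W a b N t \<epsilon>"
    and iso: "\<And>t v. t \<in> {a..b} \<Longrightarrow> norm (W t *v v) = norm v"
    and contW: "\<And>i j. continuous_on {a..b} (\<lambda>t. W t $ i $ j)"
    and contg: "continuous_on {a..b} g" and g: "\<And>t. t \<in> {a..b} \<Longrightarrow> exp (g t) = det (W t)"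
  shows "g b - g a = \<i> * of_real (angle_sum (W b) - angle_sum (W a) + 2 * pi * of_int (Maslov_sum W N t \<epsilon>))"
proof -
  have ends: "t 0 = a" "t N = b" using part by (auto simp: Maslov_partition_def)
  \<comment> \<open>The induction runs over initial segments with the partition fixed, since the
    predicate itself pins the last node to \<open>b\<close>.\<close>
  have "g (t m) - g a = \<i> * of_real (angle_sum (W (t m)) - angle_sum (W a) + 2 * pi * of_int (Maslov_sum W m t \<epsilon>))"
    if "m \<le> N" for m
    using that
  proof (induction m)
    case 0
    then show ?case by (simp add: ends Maslov_sum_def)
  next
    case (Suc m)
    have sub: "{t m..t (Suc m)} \<subseteq> {a..b}"
      using Maslov_partition_mono[OF part, of 0 m] Maslov_partition_mono[OF part, of "Suc m" N] Suc.prems ends by auto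
    have j: "Suc m \<in> {1..N}" using Suc.prems by simp
    have "g (t (Suc m)) - g (t m) = \<i> * of_real
     ((angle_sum (W (t (Suc m))) + 2 * pi * real (crossing_count (W (t (Suc m))) (\<epsilon> (Suc m))))
      - (angle_sum (W (t m)) + 2 * pi * real (crossing_count (W (t m)) (\<epsilon> (Suc m)))))"
    proof (rule log_det_increment)
      show "t m \<le> t (Suc m)" using Maslov_partition_mono[OF part, of m "Suc m"] Suc.prems by simp
      show "0 \<le> \<epsilon> (Suc m)" "\<epsilon> (Suc m) < 2 * pi"
        using Maslov_partitionD(2,3)[OF part j] by auto
      show "cis (pi + \<epsilon> (Suc m)) \<notin> mat_spectrum (W s)" if "s \<in> {t m..t (Suc m)}" for s
        using Maslov_partitionD(4)[OF part j, of s] that by simp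
    qed (use sub iso g in \<open>auto intro: continuous_on_subset[OF contW] continuous_on_subset[OF contg]\<close>)
    moreover have "g (t m) - g a = \<i> * of_real (angle_sum (W (t m)) - angle_sum (W a) + 2 * pi * of_int (Maslov_sum W m t \<epsilon>))"
      using Suc by simp
    moreover have "g (t (Suc m)) - g a = (g (t (Suc m)) - g (t m)) + (g (t m) - g a)" by simp
    ultimately have "g (t (Suc m)) - g a = \<i> * of_real
     ((angle_sum (W (t (Suc m))) + 2 * pi * real (crossing_count (W (t (Suc m))) (\<epsilon> (Suc m))))
      - (angle_sum (W (t m)) + 2 * pi * real (crossing_count (W (t m)) (\<epsilon> (Suc m))))) +
       \<i> * of_real (angle_sum (W (t m)) - angle_sum (W a) + 2 * pi * of_int (Maslov_sum W m t \<epsilon>))"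
      by (simp only:)
    then show ?case
      by (simp add: Maslov_sum_def algebra_simps)
  qed
  from this[of N] show ?thesis by (simp add: ends)
qed

text \<open>At each point only finitely many \<epsilon> are forbidden, because there are finitely
  many eigenvalues. An allowed \<epsilon> stays allowed nearby, and a Lebesgue number of the
  resulting cover gives a sufficiently fine uniform partition.\<close>

lemma Maslov_partition_exists:
  fixes W :: "real \<Rightarrow> complex ^ 'n ^ 'n"
  assumes "a \<le> b"
    and iso: "\<And>t v. t \<in> {a..b} \<Longrightarrow> norm (W t *v v) = norm v"
    and contW: "\<And>i j. continuous_on {a..b} (\<lambda>t. W t $ i $ j)"
  obtains N t \<epsilon> where "Maslov_partition W a b N t \<epsilon>"
proof (cases "a = b")
  case True
  \<comment> \<open>Strictly increasing nodes leave only the partition with no pieces when a =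
    b.\<close>
  then have "Maslov_partition W a b 0 (\<lambda>_. a) (\<lambda>_. 1)" by (simp add: Maslov_partition_def)
  then show thesis by (rule that)
next
  case False
  then have "a < b" using assms by simp
  let ?e = "\<lambda>t. eigenvalues (W t)"
  have spec: "mat_spectrum (W t) = range (?e t)" and norm1: "cmod (?e t j) = 1" if "t \<in> {a..b}" for t j
    using diagonalizes_eigenvalues[of "W t"] iso[OF that] mat_spectrum_diagonalizes by blast+
  define good where "good = (\<lambda>\<epsilon> t. cis (pi + \<epsilon>) \<notin> mat_spectrum (W t) \<and> cis (pi - \<epsilon>) \<notin> mat_spectrum (W t))"
  have ex_eps: "\<exists>\<epsilon>\<in>{0<..<pi}. good \<epsilon> x" if x: "x \<in> {a..b}" for x
  proof (rule ccontr)
    assume bad: "\<not> ?thesis"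
    have "\<epsilon> \<in> range (\<lambda>j. Arg2pi (- ?e x j)) \<union> range (\<lambda>j. Arg2pi (- cnj (?e x j)))"
      if eps: "\<epsilon> \<in> {0<..<pi}" for \<epsilon>
    proof -
      have "cis (pi + \<epsilon>) \<in> range (?e x) \<or> cis (pi - \<epsilon>) \<in> range (?e x)"
        using bad eps x by (auto simp: good_def spec)
      then have "\<exists>j. cis (pi + \<epsilon>) = ?e x j \<or> cis (pi - \<epsilon>) = ?e x j" by blast
      then obtain j where "cis (pi + \<epsilon>) = ?e x j \<or> cis (pi - \<epsilon>) = ?e x j" ..
      \<comment> \<open>Conjugation reduces the clockwise condition to the counterclockwise one, for
        the conjugate eigenvalue.\<close>
      moreover have "cnj (cis (pi - \<epsilon>)) = cis (pi + \<epsilon>)"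
        by (simp add: complex_eq_iff)
      ultimately have "?e x j = cis (pi + \<epsilon>) \<or> cnj (?e x j) = cis (pi + \<epsilon>)" by metis
      then show ?thesis
        using cis_pi_plus_eq_iff_Arg2pi[of "?e x j" \<epsilon>] cis_pi_plus_eq_iff_Arg2pi[of "cnj (?e x j)" \<epsilon>]
          norm1[OF x, of j] eps by auto
    qed
    then have "finite {0<..<pi}" by (meson finite_UnI finite_imageI finite finite_subset subsetI)
    then show False by (simp add: infinite_Ioo)
  qed
  have ex_ball: "\<exists>r>0. \<forall>y\<in>{a..b} \<inter> ball x r. good \<epsilon> y" if x: "x \<in> {a..b}" and good: "good \<epsilon> x" for x \<epsilon>
  proof -
    \<comment> \<open>A product of two characteristic determinants turns both spectral conditions
      into the nonvanishing of one continuous function.\<close>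
    define q where "q = (\<lambda>y. det (affine_mat (- cis (pi + \<epsilon>)) 1 (W y)) * det (affine_mat (- cis (pi - \<epsilon>)) 1 (W y)))"
    have q: "good \<epsilon> y \<longleftrightarrow> q y \<noteq> 0" for y by (simp add: good_def q_def mat_spectrum_eq_det)
    have "continuous_on {a..b} q"
      unfolding q_def by (intro continuous_intros continuous_on_det_affine_mat contW)
    then obtain r where "r > 0" "\<forall>y\<in>{a..b}. dist x y < r \<longrightarrow> q y \<noteq> 0"
      using continuous_on_avoid[of "{a..b}" q x 0] x good q by blast
    then show ?thesis by (intro exI[of _ r]) (auto simp: q)
  qed
  define G where "G = {T. open T \<and> (\<exists>\<epsilon>\<in>{0<..<pi}. \<forall>y\<in>{a..b} \<inter> T. good \<epsilon> y)}"
  \<comment> \<open>\<delta> is a Lebesgue number of the cover \<open>G\<close>.\<close>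
  obtain \<delta> where \<delta>: "\<delta> > 0" "\<And>x. x \<in> {a..b} \<Longrightarrow> \<exists>T\<in>G. ball x \<delta> \<subseteq> T"
  proof (rule Heine_Borel_lemma[of "{a..b}" G])
    show "{a..b} \<subseteq> \<Union> G"
    proof
      fix x assume x: "x \<in> {a..b}"
      obtain \<epsilon> where \<epsilon>: "\<epsilon> \<in> {0<..<pi}" "good \<epsilon> x" using ex_eps[OF x] by blast
      obtain r where "r > 0" "\<forall>y\<in>{a..b} \<inter> ball x r. good \<epsilon> y" using ex_ball[OF x \<epsilon>(2)] by blast
      then have "ball x r \<in> G" "x \<in> ball x r" using \<epsilon>(1) by (auto simp: G_def)
      then show "x \<in> \<Union> G" by blast
    qed
  qed (use that in \<open>auto simp: G_def\<close>)
  have "\<forall>x\<in>{a..b}. \<exists>\<epsilon>. 0 < \<epsilon> \<and> \<epsilon> < pi \<and> (\<forall>y\<in>{a..b} \<inter> ball x \<delta>. good \<epsilon> y)"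
  proof
    fix x assume "x \<in> {a..b}"
    then obtain T where "T \<in> G" "ball x \<delta> \<subseteq> T" using \<delta>(2) by blast
    then obtain \<epsilon> where "\<epsilon> \<in> {0<..<pi}" "\<forall>y\<in>{a..b} \<inter> ball x \<delta>. good \<epsilon> y" unfolding G_def by blast
    then show "\<exists>\<epsilon>. 0 < \<epsilon> \<and> \<epsilon> < pi \<and> (\<forall>y\<in>{a..b} \<inter> ball x \<delta>. good \<epsilon> y)" by auto
  qed
  then obtain E where E: "\<forall>x\<in>{a..b}. 0 < E x \<and> E x < pi \<and> (\<forall>y\<in>{a..b} \<inter> ball x \<delta>. good (E x) y)"
    by (rule bchoice[THEN exE])
  obtain N where N: "(b - a) / \<delta> < real N" using reals_Archimedean2 by blast
  have "0 < (b - a) / \<delta>" using \<open>a < b\<close> \<delta> by simp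
  then have "N > 0" using N by linarith
  define t where "t = (\<lambda>j::nat. a + real j * ((b - a) / real N))"
  have step: "0 < (b - a) / real N" "(b - a) / real N < \<delta>"
    using N \<open>a < b\<close> \<open>N > 0\<close> \<delta>(1) by (simp_all add: field_simps)
  have t_in: "t j \<in> {a..b}" if "j \<le> N" for j
  proof -
    have "real j * ((b - a) / real N) \<le> real N * ((b - a) / real N)"
      using that step by (intro mult_right_mono) auto
    then show ?thesis using \<open>N > 0\<close> \<open>a < b\<close> by (auto simp: t_def)
  qed
  have t_step: "t j = t (j - 1) + (b - a) / real N" if "j \<ge> 1" for j
    using that by (cases j) (simp_all add: t_def distrib_right add_divide_distrib)
  \<comment> \<open>Each piece is shorter than \<delta>, so the \<epsilon> chosen at its left
    endpoint works on all of it.\<close>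
  have "Maslov_partition W a b N t (\<lambda>j. E (t (j - 1)))"
    unfolding Maslov_partition_def
  proof (intro conjI ballI)
    show "t 0 = a" "t N = b" using \<open>N > 0\<close> by (auto simp: t_def)
    fix j assume j: "j \<in> {1..N}"
    show "t (j - 1) < t j" using t_step[of j] step j by simp
    have x: "t (j - 1) \<in> {a..b}" "t j \<in> {a..b}" using j t_in by auto
    show "0 < E (t (j - 1))" "E (t (j - 1)) < pi" using bspec[OF E x(1)] by auto
    fix s assume s: "s \<in> {t (j - 1)..t j}"
    then have sab: "s \<in> {a..b}" using x by auto
    moreover have "s \<in> ball (t (j - 1)) \<delta>"
      using s t_step[of j] j step by (auto simp: dist_real_def)
    ultimately have "good (E (t (j - 1))) s" using bspec[OF E x(1)] by blast
    then show "cis (pi + E (t (j - 1))) \<notin> mat_spectrum (W s)" "cis (pi - E (t (j - 1))) \<notin> mat_spectrum (W s)"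
      by (auto simp: good_def)
    have "{\<theta>. 0 \<le> \<theta> \<and> \<theta> \<le> E (t (j - 1)) \<and> cis (pi + \<theta>) \<in> mat_spectrum (W s)} \<subseteq> range (\<lambda>i. Arg2pi (- ?e s i))"
    proof
      fix \<theta> assume "\<theta> \<in> {\<theta>. 0 \<le> \<theta> \<and> \<theta> \<le> E (t (j - 1)) \<and> cis (pi + \<theta>) \<in> mat_spectrum (W s)}"
      then obtain i where "?e s i = cis (pi + \<theta>)" "0 \<le> \<theta>" "\<theta> < pi"
        using bspec[OF E x(1)] by (auto simp: spec[OF sab])
      then have "\<theta> = Arg2pi (- ?e s i)"
        using cis_pi_plus_eq_iff_Arg2pi[OF norm1[OF sab, of i], of \<theta>] by simp
      then show "\<theta> \<in> range (\<lambda>i. Arg2pi (- ?e s i))" by (rule range_eqI)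
    qed
    then show "finite {\<theta>. 0 \<le> \<theta> \<and> \<theta> \<le> E (t (j - 1)) \<and> cis (pi + \<theta>) \<in> mat_spectrum (W s)}"
      by (rule finite_subset) simp
  qed
  then show thesis by (rule that)
qed

subsection \<open>The unitary matrix of a pair of Lagrangian subspaces\<close>

definition complexify :: "real ^ ('n::finite + 'n) \<Rightarrow> complex ^ 'n" where
  "complexify z = (\<chi> i. Complex (z $ Inl i) (z $ Inr i))"

definition cnj_vec :: "complex ^ 'n \<Rightarrow> complex ^ 'n" where
  "cnj_vec v = (\<chi> i. cnj (v $ i))"

definition cnj_mat :: "complex ^ 'n ^ 'n \<Rightarrow> complex ^ 'n ^ 'n" where
  "cnj_mat A = (\<chi> i j. cnj (A $ i $ j))"

definition reflection_mat :: "(real ^ ('n::finite + 'n)) set \<Rightarrow> real ^ ('n + 'n) ^ ('n + 'n)" where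
  "reflection_mat l = 2 *\<^sub>R matrix (orth_proj l) - mat 1"

text \<open>The conjugate-linear reflection agrees with its unitary factor on real vectors, so the
  columns of that factor are the images of the basis vectors indexed by
  \<open>Inl j\<close>.\<close>

definition Souriau_mat :: "(real ^ ('n::finite + 'n)) set \<Rightarrow> complex ^ 'n ^ 'n" where
  "Souriau_mat l = (\<chi> i j. Complex (reflection_mat l $ Inl i $ Inl j) (reflection_mat l $ Inr i $ Inl j))"

lemma sum_UNIV_sum_type:
  fixes f :: "'a::finite + 'b::finite \<Rightarrow> 'c::comm_monoid_add"
  shows "(\<Sum>p\<in>UNIV. f p) = (\<Sum>i\<in>UNIV. f (Inl i)) + (\<Sum>i\<in>UNIV. f (Inr i))"
  using sum.Plus[of "UNIV :: 'a set" "UNIV :: 'b set" f] by (simp add: UNIV_Plus_UNIV)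

lemma norm_eq_sum_squares: "norm (v :: real ^ 'm) = sqrt (\<Sum>i\<in>UNIV. (v $ i)\<^sup>2)"
  by (simp add: norm_vec_def L2_set_def)

lemma norm_complexify: "norm (complexify z) = norm z"
  by (simp add: norm_eq_sum_squares sum_UNIV_sum_type)
    (simp add: norm_vec_def L2_set_def complexify_def cmod_power2 sum.distrib)

lemma norm_cnj_vec: "norm (cnj_vec v) = norm v"
  by (simp add: norm_vec_def cnj_vec_def)

lemma cnj_vec_cnj_vec [simp]: "cnj_vec (cnj_vec v) = v"
  by (simp add: cnj_vec_def vec_eq_iff)

lemma cnj_mat_mult_vec: "cnj_mat A *v v = cnj_vec (A *v cnj_vec v)"
  by (simp add: cnj_mat_def cnj_vec_def matrix_vector_mult_def vec_eq_iff)

lemma surj_complexify: "\<exists>z. v = complexify z"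
proof
  show "v = complexify (\<chi> p. case p of Inl i \<Rightarrow> Re (v $ i) | Inr i \<Rightarrow> Im (v $ i))"
    by (simp add: complexify_def vec_eq_iff)
qed

lemma J_mat_entries [simp]:
  "J_mat $ Inl i $ Inl j = 0" "J_mat $ Inr i $ Inr j = 0"
  "J_mat $ Inl i $ Inr j = (if i = j then -1 else 0)" "J_mat $ Inr i $ Inl j = (if i = j then 1 else 0)"
  by (simp_all add: J_mat_def)

lemma J_mat_mult_vec [simp]:
  "(J_mat *v x) $ Inl i = - x $ Inr i" "(J_mat *v x) $ Inr i = x $ Inl i"
  by (simp_all add: matrix_vector_mult_def sum_UNIV_sum_type if_distribR if_distrib cong: if_cong)

lemma sum_type_vec_eqI:
  assumes "\<And>i. x $ Inl i = y $ Inl i" "\<And>i. x $ Inr i = y $ Inr i"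
  shows "x = (y :: 'a ^ ('n::finite + 'n))"
proof -
  have "x $ p = y $ p" for p by (cases p) (simp_all add: assms)
  then show ?thesis by (simp add: vec_eq_iff)
qed

lemma J_mat_J_mat: "J_mat *v (J_mat *v x) = - x"
  by (rule sum_type_vec_eqI) simp_all

lemma norm_J_mat: "norm (J_mat *v x) = norm x"
  by (simp add: norm_eq_sum_squares sum_UNIV_sum_type add.commute)

section \<open>Projection and reflection for a fixed Lagrangian subspace\<close>

context
  fixes l :: "(real ^ ('n::finite + 'n)) set"
  assumes lagr: "Lagrangian l"
begin

lemma subspace_Lagrangian: "subspace l" and dim_Lagrangian: "dim l = CARD('n)"
  and isotropic_Lagrangian: "\<And>x y. x \<in> l \<Longrightarrow> y \<in> l \<Longrightarrow> (J_mat *v x) \<bullet> y = 0"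
  using lagr by (auto simp: Lagrangian_def)

text \<open>Isotropy places the image of \<open>l\<close> under J inside the orthogonal complement,
  and both have dimension n, so they coincide. Applying J again returns to \<open>l\<close>.\<close>

lemma J_mat_orthogonal_complement_in_Lagrangian:
  assumes x: "\<And>y. y \<in> l \<Longrightarrow> orthogonal y x"
  shows "J_mat *v x \<in> l"
proof -
  define C where "C = {x. \<forall>y\<in>l. orthogonal y x}"
  have "dim C + dim l = 2 * CARD('n)"
    using dim_subspace_orthogonal_to_vectors[OF subspace_Lagrangian subspace_UNIV]
    by (simp add: C_def card_cart_basis)
  then have dimC: "dim C = CARD('n)" using dim_Lagrangian by simp
  have linJ: "linear ((*v) J_mat)" and injJ: "inj ((*v) J_mat)"
    by (auto simp: inj_on_def) (metis J_mat_J_mat neg_equal_iff_equal)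
  have subC: "subspace C"
    by (auto simp: C_def subspace_def orthogonal_def inner_add_right)
  have "(*v) J_mat ` l = C"
  proof (rule subspace_dim_equal)
    show "subspace ((*v) J_mat ` l)" using linJ subspace_Lagrangian by (rule linear_subspace_image)
    show "(*v) J_mat ` l \<subseteq> C"
      using isotropic_Lagrangian by (auto simp: C_def orthogonal_def inner_commute)
    show "dim C \<le> dim ((*v) J_mat ` l)"
      using dim_image_eq[OF linJ inj_on_subset[OF injJ subset_UNIV], of l] by (simp add: dimC dim_Lagrangian)
  qed (rule subC)
  moreover have "x \<in> C" using x by (simp add: C_def)
  ultimately obtain y where "y \<in> l" "x = J_mat *v y" by blast
  then show ?thesis using subspace_neg[OF subspace_Lagrangian] by (simp add: J_mat_J_mat)
qed

text \<open>J interchanges \<open>l\<close> and its orthogonal complement, hence also the two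
  orthogonal projections.\<close>

lemma orth_proj_J_mat: "orth_proj l (J_mat *v x) = J_mat *v (x - orth_proj l x)"
proof (rule orth_proj_eqI[OF subspace_Lagrangian])
  show "J_mat *v (x - orth_proj l x) \<in> l"
    using orth_proj_props(2)[OF subspace_Lagrangian]
    by (intro J_mat_orthogonal_complement_in_Lagrangian) (simp add: orthogonal_commute)
  fix z assume "z \<in> l"
  then have "(J_mat *v orth_proj l x) \<bullet> z = 0"
    using isotropic_Lagrangian orth_proj_props(1)[OF subspace_Lagrangian] by blast
  then show "orthogonal (J_mat *v x - J_mat *v (x - orth_proj l x)) z"
    by (simp add: orthogonal_def matrix_vector_mult_diff_distrib)
qed

lemma reflection_mat_mult_vec: "reflection_mat l *v x = 2 *\<^sub>R orth_proj l x - x"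
proof -
  have "matrix (orth_proj l) *v x = orth_proj l x"
    using linear_orth_proj[OF subspace_Lagrangian] by (simp add: matrix_works linear_matrix_vector_mul_eq)
  then show ?thesis
    by (simp add: reflection_mat_def matrix_vector_mult_diff_rdistrib scaleR_matrix_vector_assoc[symmetric])
qed

lemma reflection_mat_fixes: "x \<in> l \<Longrightarrow> reflection_mat l *v x = x"
  using orth_proj_eqI[OF subspace_Lagrangian, of x x]
  by (simp add: reflection_mat_mult_vec orthogonal_def scaleR_2)

lemma reflection_mat_involution: "reflection_mat l *v (reflection_mat l *v x) = x"
proof -
  have "orth_proj l (2 *\<^sub>R orth_proj l x - x) = 2 *\<^sub>R orth_proj l (orth_proj l x) - orth_proj l x"
    using linear_orth_proj[OF subspace_Lagrangian] by (simp add: linear_diff linear_scale)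
  also have "orth_proj l (orth_proj l x) = orth_proj l x"
    using orth_proj_props(1)[OF subspace_Lagrangian]
    by (intro orth_proj_eqI[OF subspace_Lagrangian]) (auto simp: orthogonal_def)
  finally show ?thesis by (simp add: reflection_mat_mult_vec scaleR_2)
qed

lemma norm_reflection_mat: "norm (reflection_mat l *v x) = norm x"
proof -
  have "orthogonal (x - orth_proj l x) (orth_proj l x)"
    by (intro orth_proj_props subspace_Lagrangian)
  then have "(reflection_mat l *v x) \<bullet> (reflection_mat l *v x) = x \<bullet> x"
    by (simp add: reflection_mat_mult_vec orthogonal_def inner_simps inner_commute)
  then show ?thesis by (simp add: norm_eq_sqrt_inner)
qed

lemma reflection_mat_anticommutes: "reflection_mat l ** J_mat = - (J_mat ** reflection_mat l)"
proof -
  have "(reflection_mat l ** J_mat) *v x = (- (J_mat ** reflection_mat l)) *v x" for x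
  proof -
    have "(reflection_mat l ** J_mat) *v x = reflection_mat l *v (J_mat *v x)"
      by (simp add: matrix_vector_mul_assoc)
    also have "\<dots> = - (J_mat *v (reflection_mat l *v x))"
      by (simp add: reflection_mat_mult_vec orth_proj_J_mat matrix_vector_mult_diff_distrib
          matrix_vector_mult_scaleR scaleR_diff_right) (simp add: scaleR_2)
    also have "\<dots> = (- (J_mat ** reflection_mat l)) *v x"
      by (simp add: matrix_vector_mul_assoc) (simp add: matrix_vector_mult_def vec_eq_iff sum_negf)
    finally show ?thesis .
  qed
  then show ?thesis by (simp add: matrix_eq)
qed

text \<open>Comparing blocks in the anticommutation relation yields the real form of a
  conjugate-linear map.\<close>

lemma reflection_mat_blocks:
  "reflection_mat l $ Inl i $ Inr j = reflection_mat l $ Inr i $ Inl j"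
  "reflection_mat l $ Inr i $ Inr j = - reflection_mat l $ Inl i $ Inl j"
proof -
  have *: "(reflection_mat l ** J_mat) $ p $ q = - (J_mat ** reflection_mat l) $ p $ q" for p q
    by (simp add: reflection_mat_anticommutes)
  show "reflection_mat l $ Inl i $ Inr j = reflection_mat l $ Inr i $ Inl j"
    using *[of "Inl i" "Inl j"]
    by (simp add: matrix_matrix_mult_def sum_UNIV_sum_type if_distribR if_distrib cong: if_cong)
  show "reflection_mat l $ Inr i $ Inr j = - reflection_mat l $ Inl i $ Inl j"
    using *[of "Inl i" "Inr j"]
    by (simp add: matrix_matrix_mult_def sum_UNIV_sum_type if_distribR if_distrib cong: if_cong)
qed

lemma Souriau_mat_cnj_vec: "Souriau_mat l *v cnj_vec (complexify z) = complexify (reflection_mat l *v z)"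
proof -
  have "(Souriau_mat l *v cnj_vec (complexify z)) $ i = complexify (reflection_mat l *v z) $ i" for i
  proof -
    let ?R = "reflection_mat l"
    have "(Souriau_mat l *v cnj_vec (complexify z)) $ i
      = (\<Sum>j\<in>UNIV. Complex (?R $ Inl i $ Inl j * z $ Inl j + ?R $ Inl i $ Inr j * z $ Inr j)
                            (?R $ Inr i $ Inl j * z $ Inl j + ?R $ Inr i $ Inr j * z $ Inr j))"
      by (simp add: matrix_vector_mult_def Souriau_mat_def cnj_vec_def complexify_def
          reflection_mat_blocks complex_eq_iff)
    also have "\<dots> = complexify (?R *v z) $ i"
      by (simp add: complex_eq_iff complexify_def matrix_vector_mult_def sum_UNIV_sum_type sum.distrib)
    finally show ?thesis .
  qed
  then show ?thesis by (simp add: vec_eq_iff)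
qed

lemma norm_Souriau_mat: "norm (Souriau_mat l *v v) = norm v"
proof -
  obtain z where "cnj_vec v = complexify z" using surj_complexify by blast
  then have "v = cnj_vec (complexify z)" by (metis cnj_vec_cnj_vec)
  then show ?thesis by (simp add: Souriau_mat_cnj_vec norm_complexify norm_reflection_mat norm_cnj_vec)
qed

text \<open>Moving the matrix past conjugation conjugates its entries, so this product is the
  reflection applied twice.\<close>

lemma Souriau_mat_cnj_mat: "Souriau_mat l ** cnj_mat (Souriau_mat l) = mat 1"
proof -
  have "(Souriau_mat l ** cnj_mat (Souriau_mat l)) *v v = mat 1 *v v" for v
  proof -
    obtain z where z: "v = complexify z" using surj_complexify by blast
    have "(Souriau_mat l ** cnj_mat (Souriau_mat l)) *v v
      = Souriau_mat l *v cnj_vec (Souriau_mat l *v cnj_vec v)"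
      by (simp add: matrix_vector_mul_assoc[symmetric] cnj_mat_mult_vec)
    also have "\<dots> = v" by (simp add: z Souriau_mat_cnj_vec reflection_mat_involution)
    finally show ?thesis by simp
  qed
  then show ?thesis by (simp add: matrix_eq)
qed

section \<open>Frames of a Lagrangian subspace\<close>

lemma frame_exists: "\<exists>F. is_frame F l"
proof -
  obtain B where B: "B \<subseteq> l" "independent B" "l \<subseteq> span B" "card B = dim l"
    using basis_exists[of l] by blast
  then have "finite B" by (simp add: independent_imp_finite)
  then obtain h where h: "bij_betw h (UNIV :: 'n set) B"
    using finite_same_card_bij[of "UNIV :: 'n set" B] B(4) dim_Lagrangian by auto
  define F where "F = (\<chi> p j. h j $ p)"
  have col: "column j F = h j" for j by (simp add: column_def F_def)
  then have "columns F = B" using h by (auto simp: columns_def bij_betw_def)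
  moreover have "span B = l"
    using B span_minimal[OF B(1) subspace_Lagrangian] by auto
  moreover have "inj (\<lambda>j. column j F)" using h by (simp add: col bij_betw_def)
  ultimately show ?thesis using B(2) unfolding is_frame_def by blast
qed

lemma column_frame_in: "is_frame F l \<Longrightarrow> column j F \<in> l"
  unfolding is_frame_def by (metis (mono_tags, lifting) columns_def mem_Collect_eq UNIV_I span_base)

text \<open>Frame columns lie in \<open>l\<close> and are fixed by the reflection. Complexified,
  they are the columns of \<open>frame_plus F\<close>; their conjugates are those of
  \<open>frame_minus F\<close>.\<close>

lemma frame_plus_eq: 
  assumes "is_frame F l"
  shows "frame_plus F = Souriau_mat l ** frame_minus F"
proof -
  have "frame_plus F $ i $ j = (Souriau_mat l ** frame_minus F) $ i $ j" for i j
  proof -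
    have "frame_plus F $ i $ j = complexify (column j F) $ i"
      by (simp add: frame_plus_def complexify_def column_def complex_eq_iff)
    also have "\<dots> = (Souriau_mat l *v cnj_vec (complexify (column j F))) $ i"
      by (simp add: Souriau_mat_cnj_vec reflection_mat_fixes column_frame_in[OF assms])
    also have "\<dots> = (Souriau_mat l ** frame_minus F) $ i $ j"
      unfolding matrix_vector_mult_def matrix_matrix_mult_def
      by (auto intro!: sum.cong simp: cnj_vec_def complexify_def column_def frame_minus_def complex_eq_iff)
    finally show ?thesis .
  qed
  then show ?thesis by (simp add: vec_eq_iff)
qed

text \<open>Separating real and imaginary parts of a kernel vector v + i w gives F v = J (F w). Both
  \<open>F *v v\<close> and \<open>F *v w\<close> lie in \<open>l\<close>, so isotropy makes this
  vector orthogonal to itself, and injectivity of \<open>F\<close> finishes.\<close>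

lemma frame_minus_invertible:
  assumes F: "is_frame F l"
  shows "invertible (frame_minus F)"
proof -
  have "rank F = CARD('n)"
    using F by (simp add: column_rank_def is_frame_def dim_eq_card_independent columns_def
        full_SetCompr_eq card_image)
  then have injF: "inj ((*v) F)" by (simp add: full_rank_injective)
  have F_in: "F *v v \<in> l" for v
    using F by (metis is_frame_def matrix_vector_mult_in_columnspace)
  have "c = 0" if c: "frame_minus F *v c = 0" for c
  proof -
    define v where "v = (\<chi> j. Re (c $ j))"
    define w where "w = (\<chi> j. Im (c $ j))"
    define x where "x = F *v v"
    define y where "y = F *v w"
    have "(frame_minus F *v c) $ i = 0" for i using c by simp
    then have "x $ Inl i + y $ Inr i = 0 \<and> y $ Inl i - x $ Inr i = 0" for i
      by (simp add: x_def y_def v_def w_def matrix_vector_mult_def frame_minus_def complex_eq_iff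
          sum.distrib sum_subtractf)
    then have eq: "x = J_mat *v y"
      by (intro sum_type_vec_eqI) (auto simp: eq_neg_iff_add_eq_0)
    have "(J_mat *v y) \<bullet> x = 0" unfolding x_def y_def by (intro isotropic_Lagrangian F_in)
    then have x0: "x = 0" using eq by simp
    then have y0: "y = 0" using norm_J_mat[of y] eq by simp
    have "v = 0" "w = 0" using injF x0 y0 by (auto simp: x_def y_def inj_on_def)
    then show "c = 0" by (simp add: v_def w_def vec_eq_iff complex_eq_iff)
  qed
  then show ?thesis by (simp add: invertible_left_inverse matrix_left_invertible_ker)
qed

lemma frame_plus_invertible:
  assumes "is_frame F l"
  shows "invertible (frame_plus F)"
  unfolding frame_plus_eq[OF assms]
  using Souriau_mat_cnj_mat frame_minus_invertible[OF assms]
  by (intro invertible_mult) (auto simp: invertible_right_inverse)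

end

section \<open>The matrix \<open>W_tilde\<close> through reflections, and its continuity\<close>

lemma matrix_inv_right: "invertible A \<Longrightarrow> A ** matrix_inv A = mat 1"
  unfolding invertible_def matrix_inv_def by (rule someI2_ex) auto

text \<open>Substituting \<open>frame_plus_eq\<close> cancels the frames. The second pair occurs in
  the opposite order and so gives the inverse of its Souriau matrix, which is the conjugate
  matrix.\<close>

lemma W_tilde_eq_Souriau_mat:
  assumes l: "Lagrangian l1" "Lagrangian l2"
  shows "W_tilde (l1, l2) = - (Souriau_mat l1 ** cnj_mat (Souriau_mat l2))"
proof -
  define F1 where "F1 = (SOME F. is_frame F l1)"
  define F2 where "F2 = (SOME F. is_frame F l2)"
  have F: "is_frame F1 l1" "is_frame F2 l2"
    unfolding F1_def F2_def by (intro someI_ex[OF frame_exists] l)+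
  have 1: "frame_plus F1 ** matrix_inv (frame_minus F1) = Souriau_mat l1"
    unfolding frame_plus_eq[OF l(1) F(1)]
    using matrix_inv_right[OF frame_minus_invertible[OF l(1) F(1)]]
    by (simp add: matrix_mul_assoc[symmetric])
  have "cnj_mat (Souriau_mat l2) ** Souriau_mat l2 = mat 1"
    using Souriau_mat_cnj_mat[OF l(2)] by (simp add: matrix_left_right_inverse)
  then have "frame_minus F2 = cnj_mat (Souriau_mat l2) ** frame_plus F2"
    by (simp add: frame_plus_eq[OF l(2) F(2)] matrix_mul_assoc)
  then have 2: "frame_minus F2 ** matrix_inv (frame_plus F2) = cnj_mat (Souriau_mat l2)"
    using matrix_inv_right[OF frame_plus_invertible[OF l(2) F(2)]]
    by (simp add: matrix_mul_assoc[symmetric])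
  have "W_tilde (l1, l2) = - (frame_plus F1 ** matrix_inv (frame_minus F1)
      ** (frame_minus F2 ** matrix_inv (frame_plus F2)))"
    by (simp add: W_tilde_def W_frames_def F1_def F2_def matrix_mul_assoc)
  then show ?thesis by (simp add: 1 2)
qed

lemma norm_W_tilde:
  assumes l: "Lagrangian l1" "Lagrangian l2"
  shows "norm (W_tilde (l1, l2) *v v) = norm v"
proof -
  have "W_tilde (l1, l2) *v v = - (Souriau_mat l1 *v (cnj_mat (Souriau_mat l2) *v v))"
    by (simp add: W_tilde_eq_Souriau_mat[OF l] matrix_vector_mul_assoc)
       (simp add: matrix_vector_mult_def vec_eq_iff sum_negf)
  then show ?thesis
    by (simp add: norm_Souriau_mat l cnj_mat_mult_vec norm_cnj_vec)
qed

text \<open>Half of the equivalence of norms in finite dimension: \<open>nrm\<close> is Lipschitz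
  for the Euclidean norm, so it attains a minimum on the compact unit sphere, and that minimum is
  positive.\<close>

lemma matrix_norm_bounds_norm:
  fixes nrm :: "real ^ 'm ^ 'm \<Rightarrow> real"
  assumes "matrix_norm nrm"
  obtains C where "C > 0" "\<And>A. norm A \<le> C * nrm A"
proof -
  have z: "nrm A = 0 \<longleftrightarrow> A = 0" and s: "nrm (c *\<^sub>R A) = \<bar>c\<bar> * nrm A"
    and tri: "nrm (A + B) \<le> nrm A + nrm B" for A B c
    using assms unfolding matrix_norm_def by blast+
  have m: "nrm (- A) = nrm A" for A using s[of "-1" A] by simp
  have nn: "0 \<le> nrm A" for A using tri[of A "- A"] m[of A] z[of 0] by simp
  define K where "K = (\<Sum>b\<in>(Basis :: (real ^ 'm ^ 'm) set). nrm b)"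
  have nrm_sum: "nrm (\<Sum>b\<in>I. f b) \<le> (\<Sum>b\<in>I. nrm (f b))" if "finite I" for f and I :: "(real ^ 'm ^ 'm) set"
    using that
  proof (induction I)
    case (insert b I)
    then show ?case using tri[of "f b" "\<Sum>b\<in>I. f b"] by simp
  qed (use z[of 0] in simp)
  have upper: "nrm A \<le> K * norm A" for A
  proof -
    have "nrm A = nrm (\<Sum>b\<in>Basis. (A \<bullet> b) *\<^sub>R b)" by (simp only: euclidean_representation)
    also have "\<dots> \<le> (\<Sum>b\<in>Basis. nrm ((A \<bullet> b) *\<^sub>R b))" by (rule nrm_sum) simp
    also have "\<dots> \<le> (\<Sum>b\<in>Basis. norm A * nrm b)"
      by (intro sum_mono) (simp add: s mult_right_mono nn Basis_le_norm)
    finally show ?thesis by (simp add: K_def sum_distrib_left mult.commute)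
  qed
  have diff: "\<bar>nrm A - nrm B\<bar> \<le> K * dist A B" for A B
    using tri[of "A - B" B] tri[of "B - A" A] m[of "A - B"] upper[of "A - B"] by (simp add: dist_norm)
  have cont: "continuous_on S nrm" for S
    using diff by (intro lipschitz_on_continuous_on[of K] lipschitz_onI)
      (auto simp: dist_real_def K_def sum_nonneg nn)
  have "sphere (0 :: real ^ 'm ^ 'm) 1 \<noteq> {}" by simp
  then obtain U where U: "U \<in> sphere 0 1" "\<And>A. A \<in> sphere 0 1 \<Longrightarrow> nrm U \<le> nrm A"
    using continuous_attains_inf[OF compact_sphere _ cont] by metis
  have pos: "0 < nrm U" using nn[of U] z[of U] U(1) by (cases "nrm U = 0") auto
  have "norm A \<le> (1 / nrm U) * nrm A" for A
  proof (cases "A = 0")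
    case False
    have "nrm U \<le> nrm ((1 / norm A) *\<^sub>R A)" using False by (intro U(2)) simp
    also have "\<dots> = nrm A / norm A" by (simp add: s)
    finally show ?thesis using False pos by (simp add: field_simps)
  qed (simp add: nn)
  then show thesis using pos by (intro that[of "1 / nrm U"]) auto
qed

text \<open>The norm bound converts continuity for the metric on subspaces, built from an arbitrary
  \<open>nrm\<close>, into ordinary continuity of the projection matrix.\<close>

lemma continuous_on_orth_proj_matrix:
  fixes nrm :: "real ^ ('n + 'n) ^ ('n::finite + 'n) \<Rightarrow> real" and S :: "'a::topological_space set"
  assumes nrm: "matrix_norm nrm"
    and cont: "continuous_map (top_of_set S) (Lagr_top nrm) f"
  shows "continuous_on S (\<lambda>p. matrix (orth_proj (f p)))"
proof -
  interpret Metric_space Lagrangian_Grassmannian "Lagr_dist nrm"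
    by (rule Metric_space_Lagr_dist[OF nrm])
  obtain C where C: "C > 0" "\<And>A. norm A \<le> C * nrm A"
    using matrix_norm_bounds_norm[OF nrm] by blast
  show ?thesis
    unfolding continuous_on_topological
  proof (intro ballI allI impI)
    fix x B assume x: "x \<in> S" and B: "open B" "matrix (orth_proj (f x)) \<in> B"
    then obtain e where e: "e > 0" "ball (matrix (orth_proj (f x))) e \<subseteq> B"
      by (meson open_contains_ball)
    have "e / C > 0" using e C by simp
    then obtain U where U: "openin (top_of_set S) U" "x \<in> U" "\<And>y. y \<in> U \<Longrightarrow> f y \<in> mball (f x) (e / C)"
      using cont x unfolding Lagr_top_def continuous_map_to_metric by (metis topspace_euclidean_subtopology)
    obtain A where A: "open A" "U = S \<inter> A" using U(1) by (auto simp: openin_open)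
    have "matrix (orth_proj (f y)) \<in> B" if "y \<in> U" for y
    proof -
      have "nrm (matrix (orth_proj (f x)) - matrix (orth_proj (f y))) < e / C"
        using U(3)[OF that] by (simp add: Lagr_dist_def)
      then have "C * nrm (matrix (orth_proj (f x)) - matrix (orth_proj (f y))) < e"
        using C(1) by (simp add: field_simps)
      then have "dist (matrix (orth_proj (f x))) (matrix (orth_proj (f y))) < e"
        using C(2) unfolding dist_norm by (meson le_less_trans)
      then show ?thesis using e(2) by auto
    qed
    then show "\<exists>A. open A \<and> x \<in> A \<and> (\<forall>y\<in>S. y \<in> A \<longrightarrow> matrix (orth_proj (f y)) \<in> B)"
      using A U(2) by blast
  qed
qed

text \<open>This lets a continuous pair be split into continuous components.\<close>

lemma Lagr_pair_top_eq:
  fixes nrm :: "real ^ ('n + 'n) ^ ('n::finite + 'n) \<Rightarrow> real"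
  assumes "matrix_norm nrm"
  shows "Lagr_pair_top nrm = prod_topology (Lagr_top nrm) (Lagr_top nrm)"
proof -
  interpret Metric_space12 Lagrangian_Grassmannian "Lagr_dist nrm" Lagrangian_Grassmannian "Lagr_dist nrm"
    by (simp add: Metric_space12_def Metric_space_Lagr_dist[OF assms])
  show ?thesis
    by (simp add: Lagr_pair_top_def Lagr_top_def mtopology_prod_metric)
qed

lemma continuous_on_Souriau_mat:
  assumes "matrix_norm nrm" "continuous_map (top_of_set S) (Lagr_top nrm) f"
  shows "continuous_on S (\<lambda>p. Souriau_mat (f p) $ i $ j)"
proof -
  have "continuous_on S (\<lambda>p. reflection_mat (f p) $ q $ r)" for q r
    unfolding reflection_mat_def
    by (simp, intro continuous_intros continuous_on_orth_proj_matrix[OF assms])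
  then show ?thesis
    by (simp add: Souriau_mat_def Complex_eq continuous_on_add continuous_on_mult continuous_on_of_real)
qed

lemma continuous_on_W_tilde:
  assumes nrm: "matrix_norm nrm" and cont: "continuous_map (top_of_set S) (Lagr_pair_top nrm) f"
  shows "p \<in> S \<Longrightarrow> norm (W_tilde (f p) *v v) = norm v"
    and "continuous_on S (\<lambda>p. W_tilde (f p) $ i $ j)"
proof -
  interpret Metric_space Lagrangian_Grassmannian "Lagr_dist nrm"
    by (rule Metric_space_Lagr_dist[OF nrm])
  have c: "continuous_map (top_of_set S) (Lagr_top nrm) (\<lambda>p. fst (f p))"
    "continuous_map (top_of_set S) (Lagr_top nrm) (\<lambda>p. snd (f p))"
    using cont by (auto simp: Lagr_pair_top_eq[OF nrm] continuous_map_pairwise o_def)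
  have lagr: "Lagrangian (fst (f p)) \<and> Lagrangian (snd (f p))" if "p \<in> S" for p
  proof -
    have "fst (f p) \<in> Lagrangian_Grassmannian" "snd (f p) \<in> Lagrangian_Grassmannian"
      using continuous_map_funspace[OF c(1)] continuous_map_funspace[OF c(2)] that
      by (auto simp: Lagr_top_def)
    then show ?thesis by (simp add: Lagrangian_Grassmannian_def)
  qed
  show "norm (W_tilde (f p) *v v) = norm v" if "p \<in> S" for p v
    using norm_W_tilde lagr[OF that] by (metis prod.collapse)
  have "continuous_on S (\<lambda>p. - (\<Sum>k\<in>UNIV. Souriau_mat (fst (f p)) $ i $ k * cnj (Souriau_mat (snd (f p)) $ k $ j)))"
    by (intro continuous_intros continuous_on_Souriau_mat[OF nrm] c)
  moreover have "W_tilde (f p) $ i $ j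
      = - (\<Sum>k\<in>UNIV. Souriau_mat (fst (f p)) $ i $ k * cnj (Souriau_mat (snd (f p)) $ k $ j))"
    if "p \<in> S" for p
    using W_tilde_eq_Souriau_mat[of "fst (f p)" "snd (f p)"] lagr[OF that]
    by (simp add: matrix_matrix_mult_def cnj_mat_def)
  ultimately show "continuous_on S (\<lambda>p. W_tilde (f p) $ i $ j)"
    by (simp cong: continuous_on_cong)
qed

subsection \<open>Homotopy invariance\<close>

lemma det_isometry_nonzero:
  fixes A :: "complex ^ 'n ^ 'n"
  assumes "\<And>v. norm (A *v v) = norm v"
  shows "det A \<noteq> 0"
proof -
  have "A *v v = 0 \<longrightarrow> v = 0" for v
    using assms[of v] by (metis norm_eq_zero norm_zero)
  then show ?thesis
    using matrix_left_invertible_ker[of A] by (simp add: invertible_det_nz[symmetric] invertible_left_inverse)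
qed

theorem mainTheorem2:
  fixes nrm :: "real ^ ('n + 'n) ^ ('n::finite + 'n) \<Rightarrow> real"
    and a b :: real
    and L M :: "real \<Rightarrow> (real ^ ('n + 'n)) set \<times> (real ^ ('n + 'n)) set"
    and H :: "real \<Rightarrow> real \<Rightarrow> (real ^ ('n + 'n)) set \<times> (real ^ ('n + 'n)) set"
  assumes "matrix_norm nrm"
    and "a \<le> b"
    and "L \<in> Lagr_paths nrm {a..b}"
    and "M \<in> Lagr_paths nrm {a..b}"
    and "\<forall>t\<in>{a..b}. H 0 t = L t"
    and "\<forall>t\<in>{a..b}. H 1 t = M t"
    and "continuous_map (top_of_set ({a..b} \<times> {0..1})) (Lagr_pair_top nrm) (\<lambda>(t, s). H s t)"
    and "\<forall>s\<in>{0..1}. H s a = L a \<and> H s a = M a"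
    and "\<forall>s\<in>{0..1}. H s b = L b \<and> H s b = M b"
  shows "Mas L a b = Mas M a b"
proof -
  let ?K = "{a..b} \<times> {0..1::real}"
  let ?W = "\<lambda>(t, s). W_tilde (H s t)"
  have iso: "norm (?W p *v v) = norm v" if "p \<in> ?K" for p v
    using continuous_on_W_tilde(1)[OF assms(1,7) that, of v] by (simp add: case_prod_unfold)
  have contW: "continuous_on ?K (\<lambda>p. ?W p $ i $ j)" for i j
    using continuous_on_W_tilde(2)[OF assms(1,7), of i j] by (simp add: case_prod_unfold)
  obtain g where g: "continuous_on ?K g" "\<And>p. p \<in> ?K \<Longrightarrow> det (?W p) = exp (g p)"
  proof (rule continuous_logarithm_on_contractible)
    show "continuous_on ?K (\<lambda>p. det (?W p))" by (rule continuous_on_det[OF contW])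
    show "contractible ?K" by (intro convex_imp_contractible convex_Times) auto
    show "det (?W p) \<noteq> 0" if "p \<in> ?K" for p
      using iso[OF that] by (rule det_isometry_nonzero)
  qed (use that in blast)
  \<comment> \<open>On a side with fixed endpoint the determinant is constant, so a continuous
    logarithm of it is constant too.\<close>
  have edge: "g (e, 1) = g (e, 0)" if "e \<in> {a..b}" and const: "\<forall>s\<in>{0..1}. H s e = l" for e l
  proof -
    have "g (e, 1) - g (e, 0) = 0 - 0"
    proof (rule continuous_logarithms_diff)
      show "continuous_on {0..1} (\<lambda>s. g (e, s))"
        by (rule continuous_on_compose2[OF g(1)]) (use that in \<open>auto intro!: continuous_intros\<close>)
      show "exp (g (e, s)) = det (W_tilde l) * exp 0" if "s \<in> {0..1}" for s
        using g(2)[of "(e, s)"] that \<open>e \<in> {a..b}\<close> const by simp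
    qed auto
    then show ?thesis by simp
  qed
  have isoQ: "norm (W_tilde (Q t) *v v) = norm v"
    if "s \<in> {0..1}" "\<forall>t\<in>{a..b}. H s t = Q t" "t \<in> {a..b}" for s Q t v
    using iso[of "(t, s)" v] that by simp
  have contQ: "continuous_on {a..b} (\<lambda>t. W_tilde (Q t) $ i $ j)"
    if s: "s \<in> {0..1}" and Q: "\<forall>t\<in>{a..b}. H s t = Q t" for s Q i j
  proof -
    have "continuous_on {a..b} (\<lambda>t. ?W (t, s) $ i $ j)"
      by (rule continuous_on_compose2[OF contW]) (use s in \<open>auto intro!: continuous_intros\<close>)
    then show "continuous_on {a..b} (\<lambda>t. W_tilde (Q t) $ i $ j)"
      by (rule continuous_on_eq) (use Q in auto)
  qed
  \<comment> \<open>The same \<open>g\<close> serves every slice \<open>s\<close>; \<open>Q\<close>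
    stands for \<open>L\<close> at s = 0 and for \<open>M\<close> at s = 1.\<close>
  have formula: "g (b, s) - g (a, s) = \<i> * of_real (angle_sum (W_tilde (Q b)) - angle_sum (W_tilde (Q a))
      + 2 * pi * of_int (Maslov_sum (\<lambda>t. W_tilde (Q t)) N t \<epsilon>))"
    if s: "s \<in> {0..1}" and Q: "\<forall>t\<in>{a..b}. H s t = Q t"
      and part: "Maslov_partition (\<lambda>t. W_tilde (Q t)) a b N t \<epsilon>" for s Q N t \<epsilon>
  proof (rule log_det_increment_Maslov_sum[OF part])
    show "continuous_on {a..b} (\<lambda>t. g (t, s))"
      by (rule continuous_on_compose2[OF g(1)]) (use s in \<open>auto intro!: continuous_intros\<close>)
    show "exp (g (t, s)) = det (W_tilde (Q t))" if "t \<in> {a..b}" for t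
      using g(2)[of "(t, s)"] that s Q by simp
  qed (use isoQ[OF s Q] contQ[OF s Q] \<open>a \<le> b\<close> in auto)
  have exists: "\<exists>N t \<epsilon>. Maslov_partition (\<lambda>t. W_tilde (Q t)) a b N t \<epsilon>"
    if s: "s \<in> {0..1}" and Q: "\<forall>t\<in>{a..b}. H s t = Q t" for s Q
    by (rule Maslov_partition_exists[of a b "\<lambda>t. W_tilde (Q t)"])
      (use isoQ[OF s Q] contQ[OF s Q] \<open>a \<le> b\<close> in auto)
  have ends: "L a = M a" "L b = M b" using assms(8,9) by force+
  have edges: "g (a, 1) = g (a, 0)" "g (b, 1) = g (b, 0)"
    using edge[of a "L a"] edge[of b "L b"] assms(2,8,9) by auto
  have H01: "(0::real) \<in> {0..1}" "(1::real) \<in> {0..1}" by auto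
  \<comment> \<open>\<open>V Q\<close> is the predicate under the definite description in
    \<open>Mas\<close>.\<close>
  define V where "V = (\<lambda>(Q :: real \<Rightarrow> (real ^ ('n + 'n)) set \<times> (real ^ ('n + 'n)) set) m. \<exists>N t \<epsilon>. Maslov_partition (\<lambda>s. W_tilde (Q s)) a b N t \<epsilon> \<and>
      m = Maslov_sum (\<lambda>s. W_tilde (Q s)) N t \<epsilon>)"
  have eq: "m = m'" if "V L m" "V M m'" for m m'
  proof -
    have "g (b, 0) - g (a, 0) = \<i> * of_real (angle_sum (W_tilde (L b)) - angle_sum (W_tilde (L a)) + 2 * pi * of_int m)"
      using that(1) formula[OF H01(1) assms(5)] unfolding V_def by blast
    moreover have "g (b, 0) - g (a, 0) = \<i> * of_real (angle_sum (W_tilde (L b)) - angle_sum (W_tilde (L a)) + 2 * pi * of_int m')"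
      using that(2) formula[OF H01(2) assms(6)] unfolding V_def edges ends by blast
    ultimately have "2 * pi * real_of_int m = 2 * pi * real_of_int m'"
      by (simp only: mult_cancel_left of_real_eq_iff) simp
    then show ?thesis by simp
  qed
  obtain m where m: "V L m" using exists[OF H01(1) assms(5)] by (auto simp: V_def)
  obtain m' where m': "V M m'" using exists[OF H01(2) assms(6)] by (auto simp: V_def)
  \<comment> \<open>Every value for \<open>L\<close> equals every value for \<open>M\<close>, and
    both kinds exist, so the two predicates describe the same single integer.\<close>
  have "V L = V M" using eq m m' by (intro ext) metis
  then show ?thesis unfolding Mas_def V_def by (simp add: fun_eq_iff)
qed

end
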